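(* Let $n\ge 3$ be an integer and let $\alpha = 2-\frac{2}{n}$. For $\varepsilon>0$ define the function on $\mathbb{R}^n$ $$z_\varepsilon(x_1,\dots,x_n) = (1+x_1^2)(1+x_2^2)\,(\varepsilon^2+\eta^2)^{\alpha/2},\qquad \eta=\sqrt{x_3^2+\dots+x_n^2}.$$ Then the interior $C^2$ estimate fails for both equations $\det(D^2u \pm Du\otimes Du)=f(x)$, in the following specific sense: there exist constants $\rho>0$ and $\varepsilon_0>0$ such that the smooth functions $z_\varepsilon$, $\varepsilon\in(0,\varepsilon_0)$, restricted to $B_\rho(0)\subset\mathbb{R}^n$, satisfy all of the following, for each of the two choices of sign $\pm$: (a) $|D^2 z_\varepsilon(0)|\to\infty$ as $\varepsilon\to 0$. (b) The family $\{z_\varepsilon\}$ admits uniform $C^{1,1-\frac{2}{n}}$ estimates on $B_\rho(0)$: there is a constant $C$ independent of $\varepsilon$ with $\|z_\varepsilon\|_{C^{1,1-2/n}(B_\rho(0))}\le C$ for all $\varepsilon\in(0,\varepsilon_0)$. (c) The functions $f_\varepsilon := \det\big((z_\varepsilon)_{ij}\pm (z_\varepsilon)_i(z_\varepsilon)_j\big)_{1\le i,j\le n}$ admit uniform $C^2$ estimates on $B_\rho(0)$: there is a constant $C$ independent of $\varepsilon$ with $\|f_\varepsilon\|_{C^2(B_\rho(0))}\le C$ for all $\varepsilon\in(0,\varepsilon_0)$. (d) For all $\varepsilon\in(0,\varepsilon_0)$, the augmented Hessian matrix $D^2z_\varepsilon \pm Dz_\varepsilon\otimes Dz_\varepsilon$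 is positive definite at every point of $B_\rho(0)$.
   Context: $B_\rho(0)$ is the open Euclidean ball of radius $\rho$ centered at $0$ in $\mathbb{R}^n$. Subscripts on $z_\varepsilon$ after parentheses denote partial derivatives: $(z_\varepsilon)_i=\partial z_\varepsilon/\partial x_i$, $(z_\varepsilon)_{ij}=\partial^2 z_\varepsilon/\partial x_i\partial x_j$. $D^2u$ is the Hessian matrix, and $Du\otimes Du$ is the $n\times n$ matrix with entries $u_iu_j$; $|D^2 z_\varepsilon(0)|$ is any matrix norm of the Hessian at $0$. For $\beta\in(0,1)$, $\|v\|_{C^{1,\beta}(B)}=\sup_B|v|+\sup_B|Dv|+\sup_{x\ne y\in B}\frac{|Dv(x)-Dv(y)|}{|x-y|^{\beta}}$, and $\|v\|_{C^2(B)}=\sup_B|v|+\sup_B|Dv|+\sup_B|D^2v|$. *)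

theory Defs
  imports "HOL-Analysis.Analysis"
begin

definition partial :: "'n::finite \<Rightarrow> (real ^ 'n \<Rightarrow> real) \<Rightarrow> real ^ 'n \<Rightarrow> real" where
  "partial i u x = deriv (\<lambda>t. u (x + t *\<^sub>R axis i 1)) 0"

definition grad :: "(real ^ 'n::finite \<Rightarrow> real) \<Rightarrow> real ^ 'n \<Rightarrow> real ^ 'n" where
  "grad u x = (\<chi> i. partial i u x)"

definition hessian :: "(real ^ 'n::finite \<Rightarrow> real) \<Rightarrow> real ^ 'n \<Rightarrow> real ^ 'n ^ 'n" where
  "hessian u x = (\<chi> i j. partial i (partial j u) x)"

definition tensor :: "real ^ 'n::finite \<Rightarrow> real ^ 'n \<Rightarrow> real ^ 'n ^ 'n" where
  "tensor v w = (\<chi> i j. v $ i * w $ j)"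

(* The sign is encoded by the factor s, which is 1 or -1. *)
definition aug_hessian :: "real \<Rightarrow> (real ^ 'n::finite \<Rightarrow> real) \<Rightarrow> real ^ 'n \<Rightarrow> real ^ 'n ^ 'n" where
  "aug_hessian s u x = hessian u x + s *\<^sub>R tensor (grad u x) (grad u x)"

definition pos_definite :: "real ^ 'n ^ 'n::finite \<Rightarrow> bool" where
  "pos_definite A \<longleftrightarrow> transpose A = A \<and> (\<forall>v. v \<noteq> 0 \<longrightarrow> v \<bullet> (A *v v) > 0)"

(* Any norm on the vector space of matrices; submultiplicativity is not required.
   Nonnegativity follows from the three conditions. *)
definition matrix_norm :: "(real ^ 'n ^ 'n::finite \<Rightarrow> real) \<Rightarrow> bool" where
  "matrix_norm N \<longleftrightarrow>
     (\<forall>A. N A = 0 \<longleftrightarrow> A = 0) \<and>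
     (\<forall>c A. N (c *\<^sub>R A) = \<bar>c\<bar> * N A) \<and>
     (\<forall>A B. N (A + B) \<le> N A + N B)"

(* The classes C^k(S) and C^infinity(S), for open S. *)
fun Ck_on :: "nat \<Rightarrow> (real ^ 'n::finite) set \<Rightarrow> (real ^ 'n \<Rightarrow> real) \<Rightarrow> bool" where
  "Ck_on 0 S u \<longleftrightarrow> continuous_on S u"
| "Ck_on (Suc k) S u \<longleftrightarrow> u differentiable_on S \<and> (\<forall>i. Ck_on k S (partial i u))"

definition smooth_on :: "(real ^ 'n::finite) set \<Rightarrow> (real ^ 'n \<Rightarrow> real) \<Rightarrow> bool" where
  "smooth_on S u \<longleftrightarrow> (\<forall>k. Ck_on k S u)"

(* The norms take the value infinity when a supremum is infinite. They are meaningful only for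
   functions in the corresponding class, since deriv is unspecified where no derivative exists. *)
definition C1_holder_norm :: "real \<Rightarrow> (real ^ 'n::finite) set \<Rightarrow> (real ^ 'n \<Rightarrow> real) \<Rightarrow> ennreal" where
  "C1_holder_norm \<beta> S v =
     (SUP x\<in>S. ennreal \<bar>v x\<bar>) + (SUP x\<in>S. ennreal (norm (grad v x))) +
     (SUP (x, y)\<in>{(x, y). x \<in> S \<and> y \<in> S \<and> x \<noteq> y}.
        ennreal (norm (grad v x - grad v y) / norm (x - y) powr \<beta>))"

(* The norm of the Hessian is the Frobenius norm, the library norm on real ^ 'n ^ 'n. *)
definition C2_norm :: "(real ^ 'n::finite) set \<Rightarrow> (real ^ 'n \<Rightarrow> real) \<Rightarrow> ennreal" where
  "C2_norm S v =
     (SUP x\<in>S. ennreal \<bar>v x\<bar>) + (SUP x\<in>S. ennreal (norm (grad v x))) +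
     (SUP x\<in>S. ennreal (norm (hessian v x)))"

(* In eta and z, e enumerates the index type by 1, ..., n, so that x $ e k is the k-th
   coordinate of x. *)
definition eta :: "nat \<Rightarrow> (nat \<Rightarrow> 'n) \<Rightarrow> real ^ 'n::finite \<Rightarrow> real" where
  "eta n e x = sqrt (\<Sum>k=3..n. (x $ e k)\<^sup>2)"

definition z :: "nat \<Rightarrow> (nat \<Rightarrow> 'n) \<Rightarrow> real \<Rightarrow> real ^ 'n::finite \<Rightarrow> real" where
  "z n e \<epsilon> x =
     (let \<alpha> = 2 - 2 / real n in
      (1 + (x $ e 1)\<^sup>2) * (1 + (x $ e 2)\<^sup>2) * (\<epsilon>\<^sup>2 + (eta n e x)\<^sup>2) powr (\<alpha> / 2))"

end

theory Submission
  imports Defs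
begin

text \<open>
Write \<open>x = (x\<^sub>1, x\<^sub>2, y)\<close>, so that \<open>\<eta> = \<bar>y\<bar>\<close>, and put \<open>r = \<epsilon>\<^sup>2 + \<eta>\<^sup>2\<close>, \<open>a = \<alpha> / 2 = 1 - 1 / n\<close> and
\<open>t\<close> for \<open>r\<close> to the power \<open>a\<close>. The second derivatives in the directions of \<open>y\<close> are of size \<open>t / r\<close>, which at the
origin is \<open>\<epsilon>\<close> to the power \<open>- 2 / n\<close> and unbounded (\<open>hessian_blowup\<close>), whereas those in the two remaining
directions are only of size \<open>t\<close>. In the determinant, \<open>2\<close> factors of size \<open>t\<close> meet \<open>n - 2\<close> factors of size
\<open>t / r\<close>, and the exponent is chosen such that \<open>t\<^sup>2 (t / r)\<^sup>n\<^sup>-\<^sup>2 = r\<close>: the singularities cancel.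

To make this precise, the augmented Hessian is recognised as a bordered matrix, invariant under the rotations
of \<open>y\<close>-space that fix \<open>y\<close> (\<open>aug_hessian_z_split\<close>), and its determinant is evaluated by two
eliminations and the matrix determinant lemma (\<open>det_bordered\<close>). The outcome is
\<open>r U + \<epsilon>\<^sup>2 V\<close>, where \<open>U\<close> and \<open>V\<close> are polynomials in the coordinates and \<open>t\<close> (\<open>det_aug_hessian\<close>).
The function \<open>t\<close> has a bounded gradient, but its second derivatives are bounded only after
multiplication by \<open>r\<close>. Families with these bounds form an algebra, which thus contains \<open>U\<close> and \<open>V\<close>, and
multiplication by \<open>r\<close> or by \<open>\<epsilon>\<^sup>2 \<le> r\<close> turns them into families with uniform \<open>C\<^sup>2\<close> bounds
(\<open>weighted_C2_gain\<close>).

In the directions of \<open>y\<close> the gradient has the components \<open>y\<^sub>j t / r\<close>, up to Lipschitz factors; the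
other two components are Lipschitz. The field \<open>y t / r\<close> is homogeneous of degree
\<open>2 a - 1 = 1 - 2 / n\<close> for \<open>\<epsilon> = 0\<close>, and the regularisation keeps the corresponding Hoelder estimate
uniform (\<open>weighted_power_holder\<close>).

Positivity comes from a rescaling of the quadratic form by the sizes \<open>t\<close> and \<open>t / r\<close> of its diagonal entries.
In the limit at the origin it is twice the identity in the first two directions, plus a form in the
directions of \<open>y\<close> whose smallest eigenvalue is at least \<open>2 a (1 - 2 / n) > 0\<close>. The gradient terms
carry an additional factor \<open>t\<close>, so that neither sign can destroy positivity on a small ball
(\<open>quadratic_form_lower_bound\<close>).
\<close>

section \<open>Partial derivatives and smoothness\<close>

lemma partial_eqI:
  fixes u :: "real ^ 'n::finite \<Rightarrow> real"
  assumes "(u has_derivative u') (at x)"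
  shows "partial i u x = u' (axis i 1)"
proof -
  have "((\<lambda>t. x + t *\<^sub>R axis i 1) has_derivative (\<lambda>t. t *\<^sub>R axis i 1)) (at (0::real))"
    by (auto intro!: derivative_eq_intros)
  then have "((\<lambda>t. u (x + t *\<^sub>R axis i 1)) has_derivative (\<lambda>t. u' (t *\<^sub>R axis i 1))) (at 0)"
    using has_derivative_compose[of "\<lambda>t. x + t *\<^sub>R axis i 1" _ 0 UNIV u u'] assms by simp
  moreover have "(\<lambda>t. u' (t *\<^sub>R axis i 1)) = (*) (u' (axis i 1))"
    using has_derivative_bounded_linear[OF assms]
    by (auto simp: linear_simps fun_eq_iff)
  ultimately show ?thesis
    unfolding partial_def by (intro DERIV_imp_deriv) (simp add: has_field_derivative_def)
qed

lemma partial_frechet_derivative: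
  fixes u :: "real ^ 'n::finite \<Rightarrow> real"
  assumes "u differentiable at x"
  shows "partial i u x = frechet_derivative u (at x) (axis i 1)"
  using partial_eqI assms frechet_derivative_works by blast

text \<open>
A partial derivative is local although its definition mentions only a line: the line
\<open>x + t e\<^sub>i\<close> stays in a neighbourhood of \<open>x\<close> for small \<open>t\<close>. Identities that hold on a ball can
therefore be differentiated.
\<close>

lemma partial_cong_ev:
  fixes u v :: "real ^ 'n::finite \<Rightarrow> real"
  assumes "eventually (\<lambda>y. u y = v y) (nhds x)"
  shows "partial i u x = partial i v x"
proof -
  have "((\<lambda>t. x + t *\<^sub>R axis i 1) \<longlongrightarrow> x) (nhds (0::real))"
    by (rule tendsto_eq_intros filterlim_ident refl)+ simp
  then have "eventually (\<lambda>t. u (x + t *\<^sub>R axis i 1) = v (x + t *\<^sub>R axis i 1)) (nhds (0::real))"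
    using assms by (rule eventually_compose_filterlim[rotated])
  then show ?thesis
    unfolding partial_def by (rule deriv_cong_ev) simp
qed

lemma partial_cong:
  fixes u v :: "real ^ 'n::finite \<Rightarrow> real"
  assumes "open S" "x \<in> S" "\<And>y. y \<in> S \<Longrightarrow> u y = v y"
  shows "partial i u x = partial i v x"
  by (rule partial_cong_ev) (use assms eventually_nhds in blast)

lemma Ck_on_cong:
  fixes u v :: "real ^ 'n::finite \<Rightarrow> real"
  assumes "open S" "\<And>x. x \<in> S \<Longrightarrow> u x = v x" "Ck_on k S u"
  shows "Ck_on k S v"
  using assms(2,3)
proof (induction k arbitrary: u v)
  case 0
  then show ?case using continuous_on_cong by (metis Ck_on.simps(1))
next
  case (Suc k)
  have "u differentiable_on S" using Suc.prems by simp
  then have "v differentiable_on S"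
    unfolding differentiable_on_def differentiable_def
    by (metis Suc.prems(1) has_derivative_transform)
  moreover have "Ck_on k S (partial i v)" for i
  proof (rule Suc.IH[of "partial i u"])
    show "partial i u x = partial i v x" if "x \<in> S" for x
      by (rule partial_cong[OF assms(1) that Suc.prems(1)])
    show "Ck_on k S (partial i u)" using Suc.prems(2) by simp
  qed
  ultimately show ?case by simp
qed

lemma Ck_on_subset: "Ck_on k S u \<Longrightarrow> T \<subseteq> S \<Longrightarrow> Ck_on k T u"
  by (induction k arbitrary: u) (auto intro: continuous_on_subset differentiable_on_subset)

lemma Ck_on_Suc: "Ck_on (Suc k) S u \<Longrightarrow> Ck_on k S u"
  by (induction k arbitrary: u) (auto intro: differentiable_imp_continuous_on)

lemma smooth_on_differentiable: "smooth_on UNIV u \<Longrightarrow> u differentiable at x"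
  by (metis Ck_on.simps(2) UNIV_I at_within_open differentiable_on_def open_UNIV smooth_on_def)

lemma smooth_on_partial: "smooth_on S u \<Longrightarrow> smooth_on S (partial i u)"
  by (metis Ck_on.simps(2) smooth_on_def)

lemma partial_const [simp]: "partial i (\<lambda>x. c) = (\<lambda>x. 0)"
  using partial_eqI[OF has_derivative_const] by fastforce

lemma partial_add:
  assumes "u differentiable at x" "v differentiable at x"
  shows "partial i (\<lambda>x. u x + v x) x = partial i u x + partial i v x"
  using partial_eqI[OF has_derivative_add[OF assms[unfolded frechet_derivative_works]]]
    assms[THEN partial_frechet_derivative] by simp

lemma partial_mult:
  assumes "u differentiable at x" "v differentiable at x"
  shows "partial i (\<lambda>x. u x * v x) x = partial i u x * v x + u x * partial i v x"
  using partial_eqI[OF has_derivative_mult[OF assms[unfolded frechet_derivative_works]]]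
    assms[THEN partial_frechet_derivative] by simp

lemma partial_powr:
  assumes "u differentiable at x" "u x > 0"
  shows "partial i (\<lambda>x. u x powr c) x = c * (partial i u x * u x powr (c - 1))"
proof -
  let ?D = "frechet_derivative u (at x)"
  have "((\<lambda>s. s powr c) has_real_derivative c * u x powr (c - 1)) (at (u x))"
    using assms(2) has_real_derivative_powr by blast
  then have "((\<lambda>x. u x powr c) has_derivative (\<lambda>h. c * u x powr (c - 1) * ?D h)) (at x)"
    using assms(1) unfolding frechet_derivative_works
    by (intro has_derivative_compose[of u ?D x UNIV "\<lambda>s. s powr c", simplified])
      (auto simp: has_field_derivative_def)
  from partial_eqI[OF this] show ?thesis
    using partial_frechet_derivative[OF assms(1)] by simp
qed

lemma differentiable_powr:
  fixes u :: "'a::real_normed_vector \<Rightarrow> real"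
  assumes "u differentiable at x" "u x > 0"
  shows "(\<lambda>x. u x powr c) differentiable at x"
proof -
  from assms(1) obtain D where "(u has_derivative D) (at x)" by (auto simp: differentiable_def)
  from has_derivative_powr[OF this has_derivative_const assms(2), of c] show ?thesis
    by (auto simp: differentiable_def)
qed

lemma partial_coord: "partial i (\<lambda>x. x $ j) = (\<lambda>x. if i = j then 1 else 0)"
  by (rule ext, subst partial_eqI[OF bounded_linear.has_derivative[OF bounded_linear_vec_nth
        has_derivative_ident]]) (auto simp: axis_def)

lemma Ck_on_const: "Ck_on k S (\<lambda>x. c)"
  by (induction k arbitrary: c) auto

lemma Ck_on_coord: "Ck_on k S (\<lambda>x. x $ j)"
  by (cases k) (auto intro!: continuous_intros bounded_linear_imp_differentiable_on
      bounded_linear_vec_nth Ck_on_const simp: partial_coord)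

lemma Ck_on_UNIV_Suc_iff:
  "Ck_on (Suc k) UNIV u \<longleftrightarrow> (\<forall>x. u differentiable at x) \<and> (\<forall>i. Ck_on k UNIV (partial i u))"
  by (simp add: differentiable_on_def)

lemma Ck_on_add: "Ck_on k UNIV u \<Longrightarrow> Ck_on k UNIV v \<Longrightarrow> Ck_on k UNIV (\<lambda>x. u x + v x)"
proof (induction k arbitrary: u v)
  case (Suc k)
  then have d: "u differentiable at x" "v differentiable at x" for x
    by (simp_all only: Ck_on_UNIV_Suc_iff)
  moreover have "partial i (\<lambda>x. u x + v x) = (\<lambda>x. partial i u x + partial i v x)" for i
    using partial_add[OF d] by fastforce
  ultimately show ?case
    using Suc unfolding Ck_on_UNIV_Suc_iff by auto
qed (auto intro: continuous_on_add)

lemma Ck_on_mult: "Ck_on k UNIV u \<Longrightarrow> Ck_on k UNIV v \<Longrightarrow> Ck_on k UNIV (\<lambda>x. u x * v x)"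
proof (induction k arbitrary: u v)
  case (Suc k)
  then have d: "u differentiable at x" "v differentiable at x" for x
    by (simp_all only: Ck_on_UNIV_Suc_iff)
  moreover have "partial i (\<lambda>x. u x * v x) = (\<lambda>x. partial i u x * v x + u x * partial i v x)" for i
    using partial_mult[OF d] by fastforce
  ultimately show ?case
    using Suc Ck_on_Suc[OF Suc.prems(1)] Ck_on_Suc[OF Suc.prems(2)]
    unfolding Ck_on_UNIV_Suc_iff by (auto intro!: Ck_on_add)
qed (auto intro: continuous_on_mult)

text \<open>
The exponent is generalised in the induction because differentiation lowers it by one.
\<close>

lemma Ck_on_powr:
  "Ck_on k UNIV u \<Longrightarrow> (\<And>x. u x > 0) \<Longrightarrow> Ck_on k UNIV (\<lambda>x. u x powr c)"
proof (induction k arbitrary: c)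
  case 0
  then show ?case by (auto intro!: continuous_on_powr) (metis less_irrefl)
next
  case (Suc k)
  then have d: "u differentiable at x" for x
    by (simp only: Ck_on_UNIV_Suc_iff)
  moreover have "partial i (\<lambda>x. u x powr c) = (\<lambda>x. c * (partial i u x * u x powr (c - 1)))" for i
    using partial_powr[OF d Suc.prems(2)] by fastforce
  ultimately show ?case
    using Suc Ck_on_Suc[OF Suc.prems(1)]
    unfolding Ck_on_UNIV_Suc_iff by (auto intro!: Ck_on_mult Ck_on_const differentiable_powr)
qed

lemma smooth_on_const: "smooth_on S (\<lambda>x. c)"
  and smooth_on_coord: "smooth_on S (\<lambda>x. x $ j)"
  by (auto simp: smooth_on_def Ck_on_const Ck_on_coord)

lemma smooth_on_add: "smooth_on UNIV u \<Longrightarrow> smooth_on UNIV v \<Longrightarrow> smooth_on UNIV (\<lambda>x. u x + v x)"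
  and smooth_on_mult: "smooth_on UNIV u \<Longrightarrow> smooth_on UNIV v \<Longrightarrow> smooth_on UNIV (\<lambda>x. u x * v x)"
  and smooth_on_powr: "smooth_on UNIV u \<Longrightarrow> (\<And>x. u x > 0) \<Longrightarrow> smooth_on UNIV (\<lambda>x. u x powr c)"
  by (auto simp: smooth_on_def intro: Ck_on_add Ck_on_mult Ck_on_powr)

text \<open>
This reduces the smoothness of a function that is not given by arithmetic operations, such as a
squared norm, to that of its partial derivatives.
\<close>

lemma smooth_onI_partial:
  assumes "\<And>x. u differentiable at x" "\<And>i. smooth_on UNIV (partial i u)"
  shows "smooth_on UNIV u"
proof -
  have "Ck_on (Suc k) UNIV u" for k
    using assms by (simp only: Ck_on_UNIV_Suc_iff smooth_on_def) blast
  then show ?thesis unfolding smooth_on_def using Ck_on_Suc by blast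
qed

section \<open>Determinants and quadratic forms of bordered matrices\<close>

lemma matrix_add_mult_distrib: "(A + B) ** C = A ** C + B ** C"
  for A B :: "real ^ 'n ^ 'm"
  by (vector matrix_matrix_mult_def sum.distrib[symmetric] field_simps)

lemma matrix_mult_tensor: "A ** tensor u v = tensor (A *v u) v"
  by (simp add: tensor_def matrix_matrix_mult_def matrix_vector_mult_def vec_eq_iff
      sum_distrib_right mult.assoc)

lemma tensor_mult_matrix: "tensor u v ** A = tensor u (v v* A)"
  by (simp add: tensor_def matrix_matrix_mult_def vector_matrix_mult_def vec_eq_iff
      sum_distrib_left mult_ac)

lemma axis_vector_matrix_mult: "axis k (1::real) v* A = A $ k"
  using matrix_vector_mult_basis[of "transpose A" k]
  by (simp add: transpose_matrix_vector column_transpose row_def vec_nth_inverse)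

text \<open>
Only one column differs from the identity, so this is Cramer's rule for the identity matrix.
\<close>

lemma det_one_plus_column:
  fixes w :: "real ^ 'n::finite"
  shows "det (mat 1 + tensor w (axis k 1)) = 1 + w $ k"
proof -
  have "mat 1 + tensor w (axis k 1) =
      (\<chi> i j. if j = k then (mat 1 *v (axis k 1 + w)) $ i else (mat 1 :: real ^ 'n ^ 'n) $ i $ j)"
    by (simp only: matrix_vector_mul_lid) (auto simp: vec_eq_iff tensor_def axis_def mat_def)
  then show ?thesis
    by (simp only: cramer_lemma) (simp add: axis_def)
qed

text \<open>
The matrix determinant lemma. If \<open>A\<close> is the identity with one row replaced by \<open>v\<close>, then
\<open>v\<close> is a basis row vector times \<open>A\<close>, so \<open>A\<close> conjugates the rank one perturbation into one
that changes a single column.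
\<close>

lemma det_one_plus_tensor:
  fixes u v :: "real ^ 'n::finite"
  shows "det (mat 1 + tensor u v) = 1 + u \<bullet> v"
proof (cases "v = 0")
  case True
  have "tensor u 0 = 0" by (simp add: tensor_def vec_eq_iff)
  then show ?thesis using True by simp
next
  case False
  then obtain k where k: "v $ k \<noteq> 0" by (auto simp: vec_eq_iff)
  define A :: "real ^ 'n ^ 'n" where
    "A = (\<chi> i. if i = k then v else axis i 1)"
  have "A = transpose (mat 1 + tensor (v - axis k 1) (axis k 1))"
    by (auto simp: A_def vec_eq_iff transpose_def tensor_def mat_def axis_def)
  then have detA: "det A = v $ k"
    by (simp only: det_transpose det_one_plus_column) (simp add: axis_def)
  have kA: "axis k 1 v* A = v"
    by (simp add: axis_vector_matrix_mult A_def)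
  have Au: "(A *v u) $ k = u \<bullet> v"
    by (simp add: A_def matrix_vector_mult_def inner_vec_def mult.commute)
  have "A ** (mat 1 + tensor u v) = (mat 1 + tensor (A *v u) (axis k 1)) ** A"
    by (simp add: matrix_add_ldistrib matrix_add_mult_distrib matrix_mult_tensor tensor_mult_matrix kA)
  then have "det A * det (mat 1 + tensor u v) = (1 + (A *v u) $ k) * det A"
    by (metis det_mul det_one_plus_column)
  then show ?thesis using detA k Au by simp
qed

text \<open>
The left side is \<open>E A E\<^sup>T\<close> for the elementary matrix \<open>E = 1 + w \<otimes> e\<^sub>p\<close>, which has determinant
one because \<open>w\<close> vanishes at \<open>p\<close>. One such step clears the row and the column of a nonzero pivot.
\<close>

lemma det_symmetric_elimination:
  fixes A :: "real ^ 'n ^ 'n::finite"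
  assumes "w $ p = 0"
  shows "det (\<chi> i j. A$i$j + w$i * A$p$j + A$i$p * w$j + w$i * A$p$p * w$j) = det A"
proof -
  define E where "E = mat 1 + tensor w (axis p (1::real))"
  note 1 = axis_vector_matrix_mult
  have 2: "B *v axis p 1 = (\<chi> i. B $ i $ p)" for B :: "real ^ 'n ^ 'n"
    by (simp add: matrix_vector_mult_basis column_def)
  have tE: "transpose E = mat 1 + tensor (axis p 1) w"
    by (auto simp: E_def vec_eq_iff transpose_def tensor_def mat_def)
  have "(\<chi> i j. A$i$j + w$i * A$p$j + A$i$p * w$j + w$i * A$p$p * w$j) = E ** A ** transpose E"
    unfolding tE unfolding E_def
    by (simp add: matrix_add_ldistrib matrix_add_mult_distrib matrix_mult_tensor tensor_mult_matrix 1 2)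
       (simp add: vec_eq_iff tensor_def algebra_simps)
  moreover have "det E = 1"
    unfolding E_def using assms by (simp add: det_one_plus_column)
  ultimately show ?thesis by (simp add: det_mul)
qed

text \<open>
The shape that remains of a bordered matrix after both borders have been eliminated.
\<close>

lemma det_diagonal_plus_tensor:
  fixes y :: "real ^ 'n::finite"
  assumes "p \<noteq> q" "y $ p = 0" "y $ q = 0" "c \<noteq> 0"
  shows "det (\<chi> i j. (if i = j then (if i = p then a else if i = q then b else c) else 0)
      + d * y$i * y$j) = a * b * c ^ (CARD('n) - 2) * (1 + d * (y \<bullet> y) / c)"
proof -
  let ?D = "(\<chi> i j. if i = j then (if i = p then a else if i = q then b else c) else 0) :: real^'n^'n"
  have "(\<chi> i j. (if i = j then (if i = p then a else if i = q then b else c) else 0)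
      + d * y$i * y$j) = ?D ** (mat 1 + tensor ((d / c) *\<^sub>R y) y)"
  proof -
    have "?D *v w = (\<chi> i. (if i = p then a else if i = q then b else c) * w $ i)" for w
      by (simp add: vec_eq_iff matrix_vector_mult_def if_distrib[of "\<lambda>t. t * s" for s]
          cong: if_cong)
    then show ?thesis
      using assms by (simp add: matrix_add_ldistrib matrix_mult_tensor)
        (auto simp: vec_eq_iff tensor_def)
  qed
  moreover have "det ?D = a * b * c ^ (CARD('n) - 2)"
  proof -
    have "det ?D = (\<Prod>i\<in>UNIV. if i = p then a else if i = q then b else c)"
      by (subst det_diagonal) auto
    also have "\<dots> = (\<Prod>i\<in>{p, q}. if i = p then a else if i = q then b else c) *
        (\<Prod>i\<in>UNIV - {p, q}. if i = p then a else if i = q then b else c)"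
      by (simp add: prod.subset_diff[of "{p, q}" UNIV] mult.commute)
    also have "(\<Prod>i\<in>UNIV - {p, q}. if i = p then a else if i = q then b else c)
        = (\<Prod>i\<in>UNIV - {p, q}. c)"
      by (rule prod.cong) auto
    also have "\<dots> = c ^ (CARD('n) - 2)"
      using assms(1) by (simp add: card_Diff_subset numeral_2_eq_2)
    finally show ?thesis using assms(1) by simp
  qed
  ultimately show ?thesis
    by (simp add: det_mul det_one_plus_tensor)
qed

text \<open>
The common shape of all augmented Hessians considered below. The indices \<open>p\<close> and \<open>q\<close> carry
the block with entries \<open>a\<close>, \<open>m\<close>, \<open>m\<close>, \<open>b\<close>; on the other indices the matrix is
\<open>c\<close> times the identity plus \<open>d y \<otimes> y\<close>, and the two borders are the multiples \<open>u y\<close> and \<open>v y\<close>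
of the same vector \<open>y\<close>. Rotations of the other coordinates that fix \<open>y\<close> leave it invariant, so that it
behaves like a \<open>3 \<times> 3\<close> matrix together with a multiple of the identity.
\<close>

definition bordered :: "'n \<Rightarrow> 'n \<Rightarrow> real ^ 'n \<Rightarrow> real \<Rightarrow> real \<Rightarrow> real \<Rightarrow> real \<Rightarrow> real \<Rightarrow> real \<Rightarrow> real
    \<Rightarrow> real ^ 'n ^ 'n::finite" where
  "bordered p q y a b m u v c d = (\<chi> i j.
      if i = p then (if j = p then a else if j = q then m else u * y$j)
      else if i = q then (if j = p then m else if j = q then b else v * y$j)
      else (if j = p then u * y$i else if j = q then v * y$i
        else (if i = j then c else 0) + d * y$i * y$j))"

definition off_axes :: "'n \<Rightarrow> 'n \<Rightarrow> real ^ 'n \<Rightarrow> real ^ 'n::finite" where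
  "off_axes p q x = (\<chi> i. if i = p \<or> i = q then 0 else x $ i)"

lemma transpose_bordered: "transpose (bordered p q y a b m u v c d) = bordered p q y a b m u v c d"
  by (auto simp: bordered_def transpose_def vec_eq_iff)

lemma tensor_mult_vector: "tensor u v *v w = (v \<bullet> w) *\<^sub>R u"
  by (simp add: tensor_def matrix_vector_mult_def inner_vec_def vec_eq_iff sum_distrib_left
      mult_ac)

lemma bordered_quadratic_form:
  fixes y w :: "real ^ 'n::finite"
  assumes pq: "p \<noteq> q" "y $ p = 0" "y $ q = 0"
  defines "w' \<equiv> off_axes p q w"
  shows "w \<bullet> (bordered p q y a b m u v c d *v w)
    = a * (w$p)\<^sup>2 + 2 * m * w$p * w$q + b * (w$q)\<^sup>2
      + 2 * (y \<bullet> w') * (u * w$p + v * w$q) + c * (w' \<bullet> w') + d * (y \<bullet> w')\<^sup>2"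
proof -
  let ?p = "axis p (1::real)" and ?q = "axis q (1::real)"
  let ?D = "(\<chi> i j. if i = j then if i = p \<or> i = q then 0 else 1 else 0) :: real^'n^'n"
  have M: "bordered p q y a b m u v c d = a *\<^sub>R tensor ?p ?p + b *\<^sub>R tensor ?q ?q
      + m *\<^sub>R (tensor ?p ?q + tensor ?q ?p) + u *\<^sub>R (tensor ?p y + tensor y ?p)
      + v *\<^sub>R (tensor ?q y + tensor y ?q) + c *\<^sub>R ?D + d *\<^sub>R tensor y y"
    using pq by (auto simp: bordered_def vec_eq_iff tensor_def axis_def)
  have "?D *v w = w'"
    unfolding w'_def off_axes_def
    by (simp add: vec_eq_iff matrix_vector_mult_def if_distrib[of "\<lambda>t. t * s" for s] cong: if_cong)
  moreover have "w \<bullet> w' = w' \<bullet> w'" "y \<bullet> w = y \<bullet> w'"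
    unfolding w'_def off_axes_def using pq
    by (auto simp: inner_vec_def intro!: sum.cong)
  moreover have "w \<bullet> ?p = w $ p" "w \<bullet> ?q = w $ q" "w \<bullet> y = y \<bullet> w"
    by (simp_all add: inner_axis inner_commute)
  ultimately show ?thesis
    unfolding M
    by (simp add: matrix_vector_mult_add_rdistrib scaleR_matrix_vector_assoc[symmetric]
        tensor_mult_vector inner_axis inner_axis' inner_add_right)
      (simp add: power2_eq_square algebra_simps)
qed

text \<open>
Two symmetric eliminations, with the pivots \<open>a\<close> and \<open>b' = b - m\<^sup>2 / a\<close>, turn a bordered matrix into
\<open>diag(a, b', c, \<dots>, c) + d'' y \<otimes> y\<close>: the borders are multiples of \<open>y\<close>, so on
the other indices the eliminations only change the coefficient \<open>d\<close>. The pivots cancel in the product of the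
diagonal, and a polynomial remains.
\<close>

lemma det_bordered:
  fixes y :: "real ^ 'n::finite"
  assumes pq: "p \<noteq> q" "y $ p = 0" "y $ q = 0" and N: "CARD('n) \<ge> 3"
    and nz: "a \<noteq> 0" "a * b - m\<^sup>2 \<noteq> 0" "c \<noteq> 0"
  shows "det (bordered p q y a b m u v c d)
    = c ^ (CARD('n) - 3) * ((a * b - m\<^sup>2) * (c + d * (y \<bullet> y))
        - (y \<bullet> y) * (a * v\<^sup>2 - 2 * m * u * v + b * u\<^sup>2))" (is "det ?M = _")
proof -
  define b' v' d' where "b' = b - m\<^sup>2 / a" and "v' = v - m * u / a" and "d' = d - u\<^sup>2 / a"
  define d'' where "d'' = d' - v'\<^sup>2 / b'"
  have b'nz: "b' \<noteq> 0" using nz by (auto simp: b'_def field_simps power2_eq_square)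
  define A1 :: "real ^ 'n ^ 'n" where
    "A1 = (\<chi> i j. (if i = j then (if i = p then a else if i = q then b' else c) else 0)
        + (if i = q then v' * y$j else 0) + (if j = q then v' * y$i else 0) + d' * y$i * y$j)"
  define A2 :: "real ^ 'n ^ 'n" where
    "A2 = (\<chi> i j. (if i = j then (if i = p then a else if i = q then b' else c) else 0)
        + d'' * y$i * y$j)"
  \<comment> \<open>the multipliers that clear the row of \<open>p\<close>, and then that of \<open>q\<close>\<close>
  define w1 where "w1 = (m / a) *\<^sub>R axis q 1 + (u / a) *\<^sub>R y"
  define w2 where "w2 = (v' / b') *\<^sub>R y"
  have 1: "?M = (\<chi> i j. A1$i$j + w1$i * A1$p$j + A1$i$p * w1$j + w1$i * A1$p$p * w1$j)"
    using pq nz(1)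
    by (auto simp: bordered_def vec_eq_iff A1_def w1_def axis_def b'_def v'_def d'_def
        field_simps power2_eq_square)
  have 2: "A1 = (\<chi> i j. A2$i$j + w2$i * A2$q$j + A2$i$q * w2$j + w2$i * A2$q$q * w2$j)"
    using pq b'nz
    by (auto simp: vec_eq_iff A1_def A2_def w2_def d''_def field_simps power2_eq_square)
  have "det ?M = det A1"
    unfolding 1 by (rule det_symmetric_elimination) (use pq in \<open>simp add: w1_def axis_def\<close>)
  also have "det A1 = det A2"
    unfolding 2 by (rule det_symmetric_elimination) (use pq in \<open>simp add: w2_def\<close>)
  also have "\<dots> = a * b' * c ^ (CARD('n) - 2) * (1 + d'' * (y \<bullet> y) / c)"
    unfolding A2_def by (rule det_diagonal_plus_tensor) (use pq nz in auto)
  also have "c ^ (CARD('n) - 2) = c ^ (CARD('n) - 3) * c"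
    using N by (simp flip: power_Suc2 add: numeral_eq_Suc Suc_diff_Suc)
  also have "a * b' * (c ^ (CARD('n) - 3) * c) * (1 + d'' * (y \<bullet> y) / c)
      = c ^ (CARD('n) - 3) * (a * b' * c + (a * b' * d'') * (y \<bullet> y))"
    using nz by (simp add: field_simps)
  also have "a * b' * d'' = (a * b - m\<^sup>2) * d - (a * v\<^sup>2 - 2 * m * u * v + b * u\<^sup>2)"
  proof -
    have "a * b' * d'' = a * b' * d' - a * v'\<^sup>2" using b'nz by (simp add: d''_def field_simps)
    also have "a * b' * d' = (a * b - m\<^sup>2) * d - b' * u\<^sup>2"
      using nz(1) by (simp add: b'_def d'_def field_simps power2_eq_square)
    also have "b' * u\<^sup>2 = b * u\<^sup>2 - (m * u)\<^sup>2 / a"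
      using nz(1) by (simp add: b'_def field_simps power2_eq_square)
    also have "a * v'\<^sup>2 = a * v\<^sup>2 - 2 * m * u * v + (m * u)\<^sup>2 / a"
      using nz(1) by (simp add: v'_def field_simps power2_eq_square)
    finally show ?thesis by simp
  qed
  also have "a * b' = a * b - m\<^sup>2" using nz(1) by (simp add: b'_def field_simps)
  finally show ?thesis by (simp add: algebra_simps)
qed

section \<open>Families of functions with bounds uniform in the parameter\<close>

text \<open>
A family is a function of \<open>\<epsilon>\<close> and of the point; the bounds are uniform in both, over \<open>0 < \<epsilon> < 1\<close> and
the unit ball.
\<close>

definition unif_bounded :: "(real \<Rightarrow> real ^ 'n::finite \<Rightarrow> real) \<Rightarrow> bool" where
  "unif_bounded F \<longleftrightarrow> (\<exists>C. \<forall>\<epsilon>\<in>{0<..<1}. \<forall>x\<in>ball 0 1. \<bar>F \<epsilon> x\<bar> \<le> C)"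

definition unif_holder :: "real \<Rightarrow> (real \<Rightarrow> real ^ 'n::finite \<Rightarrow> real) \<Rightarrow> bool" where
  "unif_holder \<beta> F \<longleftrightarrow> (\<exists>C. \<forall>\<epsilon>\<in>{0<..<1}. \<forall>x\<in>ball 0 1. \<forall>y\<in>ball 0 1.
     \<bar>F \<epsilon> x - F \<epsilon> y\<bar> \<le> C * norm (x - y) powr \<beta>)"

text \<open>
For the weight \<open>\<omega> = 1\<close> this is a uniform \<open>C\<^sup>2\<close> bound. A weight that vanishes somewhere allows second
derivatives that blow up there at the rate \<open>1 / \<omega>\<close>; the functions and their gradients stay bounded.
\<close>

definition weighted_C2 ::
    "(real \<Rightarrow> real ^ 'n::finite \<Rightarrow> real) \<Rightarrow> (real \<Rightarrow> real ^ 'n \<Rightarrow> real) \<Rightarrow> bool" where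
  "weighted_C2 \<omega> F \<longleftrightarrow> (\<forall>\<epsilon>>0. smooth_on UNIV (F \<epsilon>)) \<and> unif_bounded F \<and>
     (\<forall>i. unif_bounded (\<lambda>\<epsilon>. partial i (F \<epsilon>))) \<and>
     (\<forall>i j. unif_bounded (\<lambda>\<epsilon> x. \<omega> \<epsilon> x * partial i (partial j (F \<epsilon>)) x))"

lemma unif_boundedI:
  "(\<And>\<epsilon> x. 0 < \<epsilon> \<Longrightarrow> \<epsilon> < 1 \<Longrightarrow> norm x < 1 \<Longrightarrow> \<bar>F \<epsilon> x\<bar> \<le> C) \<Longrightarrow> unif_bounded F"
  unfolding unif_bounded_def by (intro exI[of _ C]) auto

lemma unif_boundedE:
  assumes "unif_bounded F"
  obtains C where "C \<ge> 0" "\<And>\<epsilon> x. 0 < \<epsilon> \<Longrightarrow> \<epsilon> < 1 \<Longrightarrow> norm x < 1 \<Longrightarrow> \<bar>F \<epsilon> x\<bar> \<le> C"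
proof -
  from assms obtain C where C: "\<forall>\<epsilon>\<in>{0<..<1}. \<forall>x\<in>ball 0 1. \<bar>F \<epsilon> x\<bar> \<le> C"
    unfolding unif_bounded_def by blast
  show ?thesis
    by (rule that[of "max C 0"]) (use C in \<open>auto simp: le_max_iff_disj\<close>)
qed

lemma unif_bounded_mono:
  assumes "unif_bounded G"
    "\<And>\<epsilon> x. 0 < \<epsilon> \<Longrightarrow> \<epsilon> < 1 \<Longrightarrow> norm x < 1 \<Longrightarrow> \<bar>F \<epsilon> x\<bar> \<le> \<bar>G \<epsilon> x\<bar>"
  shows "unif_bounded F"
  using assms(1) by (elim unif_boundedE, intro unif_boundedI) (use assms(2) order_trans in blast)

lemma unif_bounded_cong:
  assumes "\<And>\<epsilon> x. 0 < \<epsilon> \<Longrightarrow> \<epsilon> < 1 \<Longrightarrow> norm x < 1 \<Longrightarrow> F \<epsilon> x = G \<epsilon> x"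
  shows "unif_bounded F \<longleftrightarrow> unif_bounded G"
  using unif_bounded_mono[of F G] unif_bounded_mono[of G F] assms by force

lemma unif_bounded_const: "unif_bounded (\<lambda>\<epsilon> x. c)"
  by (rule unif_boundedI[of _ "\<bar>c\<bar>"]) simp

lemma unif_bounded_add:
  assumes "unif_bounded F" "unif_bounded G"
  shows "unif_bounded (\<lambda>\<epsilon> x. F \<epsilon> x + G \<epsilon> x)"
proof -
  obtain C D where "\<And>\<epsilon> x. 0 < \<epsilon> \<Longrightarrow> \<epsilon> < 1 \<Longrightarrow> norm x < 1 \<Longrightarrow> \<bar>F \<epsilon> x\<bar> \<le> C"
    "\<And>\<epsilon> x. 0 < \<epsilon> \<Longrightarrow> \<epsilon> < 1 \<Longrightarrow> norm x < 1 \<Longrightarrow> \<bar>G \<epsilon> x\<bar> \<le> D"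
    using assms by (elim unif_boundedE) blast
  then show ?thesis
    by (intro unif_boundedI[of _ "C + D"]) (meson abs_triangle_ineq add_mono order_trans)
qed

lemma unif_bounded_mult:
  assumes "unif_bounded F" "unif_bounded G"
  shows "unif_bounded (\<lambda>\<epsilon> x. F \<epsilon> x * G \<epsilon> x)"
proof -
  obtain C D where "C \<ge> 0" "\<And>\<epsilon> x. 0 < \<epsilon> \<Longrightarrow> \<epsilon> < 1 \<Longrightarrow> norm x < 1 \<Longrightarrow> \<bar>F \<epsilon> x\<bar> \<le> C"
    "\<And>\<epsilon> x. 0 < \<epsilon> \<Longrightarrow> \<epsilon> < 1 \<Longrightarrow> norm x < 1 \<Longrightarrow> \<bar>G \<epsilon> x\<bar> \<le> D"
    using assms by (elim unif_boundedE) blast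
  then show ?thesis
    by (intro unif_boundedI[of _ "C * D"]) (simp add: abs_mult mult_mono)
qed

lemma unif_bounded_sum:
  assumes "\<And>i. i \<in> I \<Longrightarrow> unif_bounded (F i)"
  shows "unif_bounded (\<lambda>\<epsilon> x. \<Sum>i\<in>I. F i \<epsilon> x)"
  using assms by (induction I rule: infinite_finite_induct)
    (auto intro: unif_bounded_const unif_bounded_add)

lemma unif_bounded_abs: "unif_bounded F \<Longrightarrow> unif_bounded (\<lambda>\<epsilon> x. \<bar>F \<epsilon> x\<bar>)"
  by (rule unif_bounded_mono) auto

lemma unif_bounded_norm_vec:
  assumes "\<And>i. unif_bounded (F i)"
  shows "unif_bounded (\<lambda>\<epsilon> x. norm (\<chi> i. F i \<epsilon> x))"
  by (rule unif_bounded_mono[OF unif_bounded_sum[of UNIV "\<lambda>i \<epsilon> x. \<bar>F i \<epsilon> x\<bar>"]])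
    (use assms norm_le_l1_cart[of "\<chi> i. F i _ _"] in \<open>auto intro: unif_bounded_abs simp: sum_nonneg\<close>)

lemma unif_bounded_coord: "unif_bounded (\<lambda>\<epsilon> x. x $ i)"
  by (rule unif_boundedI[of _ 1]) (meson component_le_norm_cart less_imp_le order_trans)

lemma weighted_C2I:
  assumes "\<And>\<epsilon>. \<epsilon> > 0 \<Longrightarrow> smooth_on UNIV (F \<epsilon>)" "unif_bounded F"
    "\<And>i. unif_bounded (\<lambda>\<epsilon>. partial i (F \<epsilon>))"
    "\<And>i j. unif_bounded (\<lambda>\<epsilon> x. \<omega> \<epsilon> x * partial i (partial j (F \<epsilon>)) x)"
  shows "weighted_C2 \<omega> F"
  using assms by (auto simp: weighted_C2_def)

lemma weighted_C2D:
  assumes "weighted_C2 \<omega> F"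
  shows "\<epsilon> > 0 \<Longrightarrow> smooth_on UNIV (F \<epsilon>)" "unif_bounded F"
    "unif_bounded (\<lambda>\<epsilon>. partial i (F \<epsilon>))"
    "unif_bounded (\<lambda>\<epsilon> x. \<omega> \<epsilon> x * partial i (partial j (F \<epsilon>)) x)"
  using assms by (auto simp: weighted_C2_def)

lemma weighted_C2_const:
  fixes \<omega> :: "real \<Rightarrow> real ^ 'n::finite \<Rightarrow> real"
  shows "unif_bounded (\<lambda>\<epsilon> (x :: real ^ 'n). c \<epsilon>) \<Longrightarrow> weighted_C2 \<omega> (\<lambda>\<epsilon> x. c \<epsilon>)"
  by (rule weighted_C2I) (simp_all add: unif_bounded_const smooth_on_const)

lemma weighted_C2_coord: "weighted_C2 \<omega> (\<lambda>\<epsilon> x. x $ i)"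
  by (rule weighted_C2I) (simp_all add: unif_bounded_const smooth_on_coord
      unif_bounded_coord partial_coord)

lemma partial_partial_add:
  assumes "smooth_on UNIV u" "smooth_on UNIV v"
  shows "partial i (partial j (\<lambda>x. u x + v x)) x
    = partial i (partial j u) x + partial i (partial j v) x"
proof -
  have "partial j (\<lambda>x. u x + v x) = (\<lambda>x. partial j u x + partial j v x)"
    using assms by (simp add: fun_eq_iff partial_add smooth_on_differentiable)
  then show ?thesis
    using assms by (simp add: partial_add smooth_on_differentiable smooth_on_partial)
qed

lemma partial_partial_mult:
  assumes "smooth_on UNIV u" "smooth_on UNIV v"
  shows "partial i (partial j (\<lambda>x. u x * v x)) x
    = partial i (partial j u) x * v x + partial i u x * partial j v x
      + partial j u x * partial i v x + u x * partial i (partial j v) x"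
proof -
  have "partial j (\<lambda>x. u x * v x) = (\<lambda>x. partial j u x * v x + u x * partial j v x)"
    using assms by (simp add: fun_eq_iff partial_mult smooth_on_differentiable)
  then show ?thesis
    using assms by (simp add: partial_add partial_mult smooth_on_differentiable
        smooth_on_partial smooth_on_mult)
qed

lemma weighted_C2_add:
  assumes F: "weighted_C2 \<omega> F" and G: "weighted_C2 \<omega> G"
  shows "weighted_C2 \<omega> (\<lambda>\<epsilon> x. F \<epsilon> x + G \<epsilon> x)"
proof (rule weighted_C2I)
  note s = weighted_C2D(1)[OF F] weighted_C2D(1)[OF G]
  note b = weighted_C2D(2)[OF F] weighted_C2D(2)[OF G]
  show "smooth_on UNIV (\<lambda>x. F \<epsilon> x + G \<epsilon> x)" if "\<epsilon> > 0" for \<epsilon>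
    using s that smooth_on_add by blast
  show "unif_bounded (\<lambda>\<epsilon> x. F \<epsilon> x + G \<epsilon> x)" using b unif_bounded_add by blast
  show "unif_bounded (\<lambda>\<epsilon>. partial i (\<lambda>x. F \<epsilon> x + G \<epsilon> x))" for i
    by (rule unif_bounded_cong[THEN iffD2, OF _ unif_bounded_add[OF
            weighted_C2D(3)[OF F, of i] weighted_C2D(3)[OF G, of i]]])
      (simp add: partial_add smooth_on_differentiable s)
  show "unif_bounded (\<lambda>\<epsilon> x. \<omega> \<epsilon> x * partial i (partial j (\<lambda>x. F \<epsilon> x + G \<epsilon> x)) x)" for i j
    by (rule unif_bounded_cong[THEN iffD2, OF _ unif_bounded_add[OF
            weighted_C2D(4)[OF F, of i j] weighted_C2D(4)[OF G, of i j]]])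
      (simp add: partial_partial_add s algebra_simps)
qed

text \<open>
By the product rule, only the terms with a second derivative of one factor are sensitive to
the weight, since the mixed terms contain first derivatives only.
\<close>

lemma weighted_C2_mult_general:
  assumes F: "weighted_C2 \<omega>1 F" and G: "weighted_C2 \<omega>2 G" and "unif_bounded \<omega>"
    and FG: "\<And>i j. unif_bounded (\<lambda>\<epsilon> x. \<omega> \<epsilon> x * partial i (partial j (F \<epsilon>)) x * G \<epsilon> x)"
      "\<And>i j. unif_bounded (\<lambda>\<epsilon> x. \<omega> \<epsilon> x * partial i (partial j (G \<epsilon>)) x * F \<epsilon> x)"
  shows "weighted_C2 \<omega> (\<lambda>\<epsilon> x. F \<epsilon> x * G \<epsilon> x)"
proof (rule weighted_C2I)
  note s = weighted_C2D(1)[OF F] weighted_C2D(1)[OF G]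
  note b = weighted_C2D(2)[OF F] weighted_C2D(2)[OF G]
  note p = weighted_C2D(3)[OF F] weighted_C2D(3)[OF G]
  show "smooth_on UNIV (\<lambda>x. F \<epsilon> x * G \<epsilon> x)" if "\<epsilon> > 0" for \<epsilon>
    using s that smooth_on_mult by blast
  show "unif_bounded (\<lambda>\<epsilon> x. F \<epsilon> x * G \<epsilon> x)" using b unif_bounded_mult by blast
  show "unif_bounded (\<lambda>\<epsilon>. partial i (\<lambda>x. F \<epsilon> x * G \<epsilon> x))" for i
    by (rule unif_bounded_cong[THEN iffD2, OF _ unif_bounded_add[OF
            unif_bounded_mult[OF p(1) b(2)] unif_bounded_mult[OF b(1) p(2)]]])
      (simp add: partial_mult smooth_on_differentiable s)
  show "unif_bounded (\<lambda>\<epsilon> x. \<omega> \<epsilon> x * partial i (partial j (\<lambda>x. F \<epsilon> x * G \<epsilon> x)) x)" for i j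
    by (rule unif_bounded_cong[THEN iffD2, OF _ unif_bounded_add[OF
            unif_bounded_add[OF FG(1)[of i j] FG(2)[of i j]]
            unif_bounded_mult[OF assms(3) unif_bounded_add[OF
              unif_bounded_mult[OF p(1)[of i] p(2)[of j]]
              unif_bounded_mult[OF p(1)[of j] p(2)[of i]]]]]])
      (simp add: partial_partial_mult s algebra_simps)
qed

lemma weighted_C2_mult:
  assumes "unif_bounded \<omega>" "weighted_C2 \<omega> F" "weighted_C2 \<omega> G"
  shows "weighted_C2 \<omega> (\<lambda>\<epsilon> x. F \<epsilon> x * G \<epsilon> x)"
  using weighted_C2_mult_general[OF assms(2,3,1)]
    unif_bounded_mult[OF weighted_C2D(4)[OF assms(2)] weighted_C2D(2)[OF assms(3)]]
    unif_bounded_mult[OF weighted_C2D(4)[OF assms(3)] weighted_C2D(2)[OF assms(2)]] .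

lemma weighted_C2_power:
  assumes "unif_bounded \<omega>" "weighted_C2 \<omega> F"
  shows "weighted_C2 \<omega> (\<lambda>\<epsilon> x. F \<epsilon> x ^ k)"
  by (induction k) (auto intro!: weighted_C2_mult weighted_C2_const unif_bounded_const assms)

lemma weighted_C2_diff:
  assumes "unif_bounded \<omega>" "weighted_C2 \<omega> F" "weighted_C2 \<omega> G"
  shows "weighted_C2 \<omega> (\<lambda>\<epsilon> x. F \<epsilon> x - G \<epsilon> x)"
proof -
  have "weighted_C2 \<omega> (\<lambda>\<epsilon> x. F \<epsilon> x + (- 1) * G \<epsilon> x)"
    by (intro weighted_C2_add weighted_C2_mult weighted_C2_const unif_bounded_const assms)
  then show ?thesis by simp
qed

text \<open>
Multiplication by a \<open>C\<^sup>2\<close> family that is dominated by the weight removes the weight: the factor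
absorbs the blow-up of the second derivatives.
\<close>

lemma weighted_C2_gain:
  assumes F: "weighted_C2 \<omega> F" and G: "weighted_C2 (\<lambda>_ _. 1) G"
    and le: "\<And>\<epsilon> x. 0 < \<epsilon> \<Longrightarrow> \<epsilon> < 1 \<Longrightarrow> norm x < 1 \<Longrightarrow> \<bar>G \<epsilon> x\<bar> \<le> \<bar>\<omega> \<epsilon> x\<bar>"
  shows "weighted_C2 (\<lambda>_ _. 1) (\<lambda>\<epsilon> x. G \<epsilon> x * F \<epsilon> x)"
proof (rule weighted_C2_mult_general[OF G F unif_bounded_const])
  show "unif_bounded (\<lambda>\<epsilon> x. 1 * partial i (partial j (G \<epsilon>)) x * F \<epsilon> x)" for i j
    by (rule unif_bounded_mult[OF weighted_C2D(4)[OF G] weighted_C2D(2)[OF F]])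
  show "unif_bounded (\<lambda>\<epsilon> x. 1 * partial i (partial j (F \<epsilon>)) x * G \<epsilon> x)" for i j
    by (rule unif_bounded_mono[OF weighted_C2D(4)[OF F, of i j]])
      (simp add: abs_mult mult.commute mult_right_mono le)
qed

section \<open>Uniform Hoelder bounds\<close>

lemma unif_holder_mult:
  assumes "unif_holder \<beta> F" "unif_holder \<beta> G" "unif_bounded F" "unif_bounded G"
  shows "unif_holder \<beta> (\<lambda>\<epsilon> x. F \<epsilon> x * G \<epsilon> x)"
proof -
  obtain C D where C: "\<forall>\<epsilon>\<in>{0<..<1}. \<forall>x\<in>ball 0 1. \<forall>y\<in>ball 0 1.
     \<bar>F \<epsilon> x - F \<epsilon> y\<bar> \<le> C * norm (x - y) powr \<beta>"
   and D: "\<forall>\<epsilon>\<in>{0<..<1}. \<forall>x\<in>ball 0 1. \<forall>y\<in>ball 0 1.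
     \<bar>G \<epsilon> x - G \<epsilon> y\<bar> \<le> D * norm (x - y) powr \<beta>"
    using assms unfolding unif_holder_def by blast
  obtain A B where AB: "A \<ge> 0" "\<And>\<epsilon> x. 0 < \<epsilon> \<Longrightarrow> \<epsilon> < 1 \<Longrightarrow> norm x < 1 \<Longrightarrow> \<bar>F \<epsilon> x\<bar> \<le> A"
    "B \<ge> 0" "\<And>\<epsilon> x. 0 < \<epsilon> \<Longrightarrow> \<epsilon> < 1 \<Longrightarrow> norm x < 1 \<Longrightarrow> \<bar>G \<epsilon> x\<bar> \<le> B"
    using assms(3,4) by (elim unif_boundedE) blast
  show ?thesis unfolding unif_holder_def
  proof (intro exI[of _ "C * B + A * D"] ballI)
    fix \<epsilon> :: real and x y :: "real ^ 'a" assume *: "\<epsilon> \<in> {0<..<1}" "x \<in> ball 0 1" "y \<in> ball 0 1"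
    have "0 \<le> C * norm (x - y) powr \<beta>" using * C abs_ge_zero order_trans by blast
    have "\<bar>F \<epsilon> x * G \<epsilon> x - F \<epsilon> y * G \<epsilon> y\<bar> = \<bar>(F \<epsilon> x - F \<epsilon> y) * G \<epsilon> x + F \<epsilon> y * (G \<epsilon> x - G \<epsilon> y)\<bar>"
      by (simp add: algebra_simps)
    also have "\<dots> \<le> \<bar>F \<epsilon> x - F \<epsilon> y\<bar> * \<bar>G \<epsilon> x\<bar> + \<bar>F \<epsilon> y\<bar> * \<bar>G \<epsilon> x - G \<epsilon> y\<bar>"
      by (metis abs_mult abs_triangle_ineq)
    also have "\<dots> \<le> (C * norm (x - y) powr \<beta>) * B + A * (D * norm (x - y) powr \<beta>)"
      using * C D AB \<open>0 \<le> C * _\<close> by (intro add_mono mult_mono) auto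
    finally show "\<bar>F \<epsilon> x * G \<epsilon> x - F \<epsilon> y * G \<epsilon> y\<bar> \<le> (C * B + A * D) * norm (x - y) powr \<beta>"
      by (simp add: algebra_simps)
  qed
qed

lemma le_two_powr:
  assumes "0 \<le> s" "s \<le> 2" "0 < \<beta>" "\<beta> \<le> (1::real)"
  shows "s \<le> 2 * s powr \<beta>"
proof (cases "s = 0")
  case False
  then have "s = s powr (1 - \<beta>) * s powr \<beta>" using assms by (simp flip: powr_add)
  also have "s powr (1 - \<beta>) \<le> 2 powr (1 - \<beta>)" using assms by (intro powr_mono2) auto
  also have "2 powr (1 - \<beta>) \<le> (2::real) powr 1" using assms by (intro powr_mono) auto
  finally show ?thesis by (simp add: mult_right_mono)
qed simp

text \<open>
The gradient is bounded uniformly, so the family is uniformly Lipschitz, and a Lipschitz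
function on a bounded set is Hoelder continuous with any exponent at most one.
\<close>

lemma weighted_C2_imp_holder:
  fixes F :: "real \<Rightarrow> real ^ 'n::finite \<Rightarrow> real"
  assumes F: "weighted_C2 \<omega> F" and \<beta>: "0 < \<beta>" "\<beta> \<le> 1"
  shows "unif_holder \<beta> F"
proof -
  have "unif_bounded (\<lambda>\<epsilon> x. \<Sum>i\<in>UNIV. \<bar>partial i (F \<epsilon>) x\<bar>)"
    by (intro unif_bounded_sum unif_bounded_abs weighted_C2D[OF F])
  then obtain C where C: "C \<ge> 0" "\<And>\<epsilon> x. 0 < \<epsilon> \<Longrightarrow> \<epsilon> < 1 \<Longrightarrow> norm x < 1 \<Longrightarrow>
      (\<Sum>i\<in>UNIV. \<bar>partial i (F \<epsilon>) x\<bar>) \<le> C"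
    by (elim unif_boundedE) (smt (verit, best) abs_ge_self)
  show ?thesis unfolding unif_holder_def
  proof (intro exI[of _ "C * 2"] ballI)
    fix \<epsilon> :: real and x y :: "real ^ 'n"
    assume *: "\<epsilon> \<in> {0<..<1}" "x \<in> ball 0 1" "y \<in> ball 0 1"
    define F' where "F' w = frechet_derivative (F \<epsilon>) (at w)" for w
    have d: "F \<epsilon> differentiable at w" for w
      using weighted_C2D(1)[OF F] * smooth_on_differentiable by auto
    have "norm (F \<epsilon> x - F \<epsilon> y) \<le> C * norm (x - y)"
    proof (rule differentiable_bound[of "ball 0 1" "F \<epsilon>" F'])
      show "(F \<epsilon> has_derivative F' w) (at w within ball 0 1)" for w
        using d frechet_derivative_works has_derivative_at_withinI unfolding F'_def by blast
      show "onorm (F' w) \<le> C" if w: "w \<in> ball 0 1" for w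
      proof (rule onorm_bound[OF C(1)])
        fix h
        have lin: "linear (F' w)"
          unfolding F'_def using d by (rule linear_frechet_derivative)
        have "F' w h = F' w (\<Sum>i\<in>UNIV. h $ i *\<^sub>R axis i 1)"
          by (simp add: basis_expansion flip: scalar_mult_eq_scaleR)
        also have "\<dots> = (\<Sum>i\<in>UNIV. h $ i * partial i (F \<epsilon>) w)"
          by (simp add: linear_sum[OF lin] linear_cmul[OF lin] partial_frechet_derivative[OF d, folded F'_def])
        also have "\<bar>\<dots>\<bar> \<le> (\<Sum>i\<in>UNIV. norm h * \<bar>partial i (F \<epsilon>) w\<bar>)"
          by (rule order_trans[OF sum_abs]) (auto intro!: sum_mono mult_right_mono
              simp: abs_mult component_le_norm_cart)
        also have "\<dots> = (\<Sum>i\<in>UNIV. \<bar>partial i (F \<epsilon>) w\<bar>) * norm h"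
          by (simp add: sum_distrib_left mult.commute)
        also have "\<dots> \<le> C * norm h"
          using w * by (intro mult_right_mono C) auto
        finally show "norm (F' w h) \<le> C * norm h" by simp
      qed
    qed (use * in auto)
    also have "norm (x - y) \<le> 2 * norm (x - y) powr \<beta>"
      using * norm_triangle_ineq4[of x y] by (intro le_two_powr \<beta>) auto
    finally show "\<bar>F \<epsilon> x - F \<epsilon> y\<bar> \<le> C * 2 * norm (x - y) powr \<beta>"
      using C(1) by (simp add: mult_left_mono mult.assoc)
  qed
qed

section \<open>Passage to the norms\<close>

lemma C2_norm_cong:
  assumes "open S" "\<And>x. x \<in> S \<Longrightarrow> u x = v x"
  shows "C2_norm S u = C2_norm S v"
proof -
  have p: "partial i u x = partial i v x" if "x \<in> S" for i x
    by (rule partial_cong[OF assms(1) that assms(2)])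
  have "partial i (partial j u) x = partial i (partial j v) x" if "x \<in> S" for i j x
    by (rule partial_cong[OF assms(1) that p])
  with p assms(2) show ?thesis
    unfolding C2_norm_def grad_def hessian_def
    by (intro arg_cong2[where f = "(+)"] SUP_cong refl) auto
qed

lemma C2_norm_bounded:
  fixes F :: "real \<Rightarrow> real ^ 'n::finite \<Rightarrow> real"
  assumes F: "weighted_C2 (\<lambda>_ _. 1) F" and S: "S \<subseteq> ball 0 1"
  shows "\<exists>C::real. \<forall>\<epsilon>\<in>{0<..<1}. C2_norm S (F \<epsilon>) \<le> ennreal C"
proof -
  have "unif_bounded (\<lambda>\<epsilon> x. norm (\<chi> i. partial i (F \<epsilon>) x))"
    by (intro unif_bounded_norm_vec weighted_C2D[OF F])
  then obtain B where B: "B \<ge> 0" "\<And>\<epsilon> x. 0 < \<epsilon> \<Longrightarrow> \<epsilon> < 1 \<Longrightarrow> norm x < 1 \<Longrightarrow>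
      norm (grad (F \<epsilon>) x) \<le> B"
    by (elim unif_boundedE) (simp add: grad_def)
  have "unif_bounded (\<lambda>\<epsilon> x. \<Sum>i\<in>UNIV. norm (\<chi> j. partial i (partial j (F \<epsilon>)) x))"
    using weighted_C2D(4)[OF F] by (intro unif_bounded_sum unif_bounded_norm_vec) simp
  then obtain D where D: "D \<ge> 0" "\<And>\<epsilon> x. 0 < \<epsilon> \<Longrightarrow> \<epsilon> < 1 \<Longrightarrow> norm x < 1 \<Longrightarrow>
      (\<Sum>i\<in>UNIV. norm (\<chi> j. partial i (partial j (F \<epsilon>)) x)) \<le> D"
    by (elim unif_boundedE) (smt (verit, best) abs_ge_self)
  obtain A where A: "A \<ge> 0" "\<And>\<epsilon> x. 0 < \<epsilon> \<Longrightarrow> \<epsilon> < 1 \<Longrightarrow> norm x < 1 \<Longrightarrow> \<bar>F \<epsilon> x\<bar> \<le> A"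
    using weighted_C2D(2)[OF F] by (elim unif_boundedE) blast
  have H: "norm (hessian u x) \<le> (\<Sum>i\<in>UNIV. norm (\<chi> j. partial i (partial j u) x))"
    for u :: "real ^ 'n \<Rightarrow> real" and x
    unfolding norm_vec_def[of "hessian u x"]
    by (rule order_trans[OF L2_set_le_sum]) (simp_all add: hessian_def)
  show ?thesis
  proof (intro exI[of _ "A + B + D"] ballI)
    fix \<epsilon> :: real assume "\<epsilon> \<in> {0<..<1}"
    then have "C2_norm S (F \<epsilon>) \<le> ennreal A + ennreal B + ennreal D"
      unfolding C2_norm_def using S A B order_trans[OF H D(2)]
      by (intro add_mono SUP_least ennreal_leI) auto
    then show "C2_norm S (F \<epsilon>) \<le> ennreal (A + B + D)" using A B D by simp
  qed
qed

lemma C1_holder_norm_bounded: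
  fixes F :: "real \<Rightarrow> real ^ 'n::finite \<Rightarrow> real"
  assumes F: "unif_bounded F" "\<And>i. unif_bounded (\<lambda>\<epsilon>. partial i (F \<epsilon>))"
    and "\<And>i. unif_holder \<beta> (\<lambda>\<epsilon>. partial i (F \<epsilon>))" and S: "S \<subseteq> ball 0 1"
  shows "\<exists>C::real. \<forall>\<epsilon>\<in>{0<..<1}. C1_holder_norm \<beta> S (F \<epsilon>) \<le> ennreal C"
proof -
  have "unif_bounded (\<lambda>\<epsilon> x. norm (\<chi> i. partial i (F \<epsilon>) x))"
    by (intro unif_bounded_norm_vec F)
  then obtain B where B: "B \<ge> 0" "\<And>\<epsilon> x. 0 < \<epsilon> \<Longrightarrow> \<epsilon> < 1 \<Longrightarrow> norm x < 1 \<Longrightarrow>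
      norm (grad (F \<epsilon>) x) \<le> B"
    by (elim unif_boundedE) (simp add: grad_def)
  obtain A where A: "A \<ge> 0" "\<And>\<epsilon> x. 0 < \<epsilon> \<Longrightarrow> \<epsilon> < 1 \<Longrightarrow> norm x < 1 \<Longrightarrow> \<bar>F \<epsilon> x\<bar> \<le> A"
    using F(1) by (elim unif_boundedE) blast
  obtain D where D: "\<And>i. \<forall>\<epsilon>\<in>{0<..<1}. \<forall>x\<in>ball 0 1. \<forall>y\<in>ball 0 1.
     \<bar>partial i (F \<epsilon>) x - partial i (F \<epsilon>) y\<bar> \<le> D i * norm (x - y) powr \<beta>"
    using assms(3) unfolding unif_holder_def by metis
  have H: "norm (grad (F \<epsilon>) x - grad (F \<epsilon>) y) / norm (x - y) powr \<beta> \<le> max 0 (\<Sum>i\<in>UNIV. D i)"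
    if "\<epsilon> \<in> {0<..<1}" "x \<in> S" "y \<in> S" "x \<noteq> y" for \<epsilon> x y
  proof -
    have "norm (grad (F \<epsilon>) x - grad (F \<epsilon>) y) \<le> (\<Sum>i\<in>UNIV. \<bar>partial i (F \<epsilon>) x - partial i (F \<epsilon>) y\<bar>)"
      using norm_le_l1_cart[of "grad (F \<epsilon>) x - grad (F \<epsilon>) y"] by (simp add: grad_def)
    also have "\<dots> \<le> (\<Sum>i\<in>UNIV. D i * norm (x - y) powr \<beta>)"
      using D that S by (intro sum_mono) blast
    also have "\<dots> = (\<Sum>i\<in>UNIV. D i) * norm (x - y) powr \<beta>" by (simp add: sum_distrib_right)
    finally show ?thesis using that(4) by (simp add: field_simps le_max_iff_disj)
  qed
  show ?thesis
  proof (intro exI[of _ "A + B + max 0 (\<Sum>i\<in>UNIV. D i)"] ballI)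
    fix \<epsilon> :: real assume e: "\<epsilon> \<in> {0<..<1}"
    then have "C1_holder_norm \<beta> S (F \<epsilon>) \<le> ennreal A + ennreal B + ennreal (max 0 (\<Sum>i\<in>UNIV. D i))"
      unfolding C1_holder_norm_def using S A B H[OF e]
      by (intro add_mono SUP_least ennreal_leI) auto
    then show "C1_holder_norm \<beta> S (F \<epsilon>) \<le> ennreal (A + B + max 0 (\<Sum>i\<in>UNIV. D i))"
      using A B by (simp add: ennreal_plus)
  qed
qed

section \<open>A Hoelder estimate for regularised powers\<close>

text \<open>
The field \<open>\<phi>(\<bar>u\<bar>) u\<close> is Hoelder continuous with a constant that does not depend on \<open>e\<close>. Two
monotonicity properties give this without derivatives: \<open>\<phi>\<close> decreases, whereas \<open>s \<phi>(s)\<close> increases.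
For \<open>\<bar>u\<bar> \<le> \<bar>v\<bar>\<close> they bound both parts of
\<open>\<phi>(\<bar>u\<bar>) u - \<phi>(\<bar>v\<bar>) v = \<phi>(\<bar>v\<bar>) (u - v) + (\<phi>(\<bar>u\<bar>) - \<phi>(\<bar>v\<bar>)) u\<close>
by \<open>\<phi>(\<bar>v\<bar>) \<bar>u - v\<bar>\<close>. Since \<open>\<bar>u - v\<bar> \<le> 2 \<bar>v\<bar>\<close> and \<open>\<phi>(\<bar>v\<bar>) \<le> \<bar>v\<bar>\<close> to the power \<open>2 b\<close>, a power of the
distance remains.
\<close>

lemma weighted_power_holder:
  fixes u v :: "'a::real_normed_vector"
  assumes e: "e > 0" and b: "- 1/2 < b" "b \<le> 0"
  defines "\<phi> \<equiv> \<lambda>s. (e\<^sup>2 + s\<^sup>2) powr b"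
  shows "norm (\<phi> (norm u) *\<^sub>R u - \<phi> (norm v) *\<^sub>R v) \<le> 4 * norm (u - v) powr (2 * b + 1)"
proof -
  have pos: "e\<^sup>2 + s\<^sup>2 > 0" for s using e by (simp add: add_pos_nonneg)
  have anti: "\<phi> t \<le> \<phi> s" if "0 \<le> s" "s \<le> t" for s t
    unfolding \<phi>_def using that b pos
    by (intro powr_mono2') (auto intro: power_mono)
  have mono: "s * \<phi> s \<le> t * \<phi> t" if st: "0 \<le> s" "s \<le> t" for s t
  proof (rule power2_le_imp_le)
    \<comment> \<open>the square is a product of two increasing functions of \<open>s\<close>\<close>
    have sq: "(s * \<phi> s)\<^sup>2 = s\<^sup>2 / (e\<^sup>2 + s\<^sup>2) * (e\<^sup>2 + s\<^sup>2) powr (2 * b + 1)" for s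
    proof -
      have "(e\<^sup>2 + s\<^sup>2) powr (2 * b + 1) = (e\<^sup>2 + s\<^sup>2) powr (b + b) * (e\<^sup>2 + s\<^sup>2) powr 1"
        by (simp only: powr_add[symmetric] mult_2)
      also have "\<dots> = (\<phi> s)\<^sup>2 * (e\<^sup>2 + s\<^sup>2)"
        using pos[of s] by (simp only: powr_add) (simp add: \<phi>_def power2_eq_square[of "_ powr b"])
      finally show ?thesis using pos[of s] by (simp add: power_mult_distrib)
    qed
    have "s\<^sup>2 / (e\<^sup>2 + s\<^sup>2) \<le> t\<^sup>2 / (e\<^sup>2 + t\<^sup>2)"
      using pos[of s] pos[of t] st power_mono[of s t 2]
      by (simp add: divide_simps) (simp add: algebra_simps mult_left_mono)
    moreover have "(e\<^sup>2 + s\<^sup>2) powr (2 * b + 1) \<le> (e\<^sup>2 + t\<^sup>2) powr (2 * b + 1)"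
      using st b pos[of s] by (intro powr_mono2) (auto intro: power_mono)
    ultimately show "(s * \<phi> s)\<^sup>2 \<le> (t * \<phi> t)\<^sup>2"
      unfolding sq using pos[of t] by (intro mult_mono) auto
    show "0 \<le> t * \<phi> t" using st by (simp add: \<phi>_def)
  qed
  have main: "norm (\<phi> (norm u) *\<^sub>R u - \<phi> (norm v) *\<^sub>R v) \<le> 4 * norm (u - v) powr (2 * b + 1)"
    if uv: "norm u \<le> norm v" for u v :: 'a
  proof (cases "u = v")
    case False
    define d where "d = norm (u - v)"
    have d: "d > 0" "d \<le> 2 * norm v"
      using False uv norm_triangle_ineq4[of u v] by (auto simp: d_def)
    have "\<phi> (norm u) *\<^sub>R u - \<phi> (norm v) *\<^sub>R v
        = \<phi> (norm v) *\<^sub>R (u - v) + (\<phi> (norm u) - \<phi> (norm v)) *\<^sub>R u"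
      by (simp add: algebra_simps)
    also have "norm \<dots> \<le> \<phi> (norm v) * d + (\<phi> (norm u) - \<phi> (norm v)) * norm u"
      using anti[OF norm_ge_zero uv] unfolding d_def
      by (intro order_trans[OF norm_triangle_ineq]) (simp add: \<phi>_def)
    also have "(\<phi> (norm u) - \<phi> (norm v)) * norm u \<le> \<phi> (norm v) * (norm v - norm u)"
      using mono[OF norm_ge_zero uv] by (simp add: algebra_simps)
    also have "\<dots> \<le> \<phi> (norm v) * d"
      unfolding d_def using norm_triangle_ineq3[of u v]
      by (intro mult_left_mono) (auto simp: \<phi>_def)
    also have "\<phi> (norm v) \<le> ((norm v)\<^sup>2) powr b"
      unfolding \<phi>_def using d b e by (intro powr_mono2') auto
    also have "((norm v)\<^sup>2) powr b = norm v powr (2 * b)"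
      using d by (simp add: powr_powr flip: powr_numeral)
    also have "\<dots> \<le> (d / 2) powr (2 * b)"
      using d b by (intro powr_mono2') auto
    also have "(d / 2) powr (2 * b) = 2 powr (- (2 * b)) * d powr (2 * b)"
      using d by (simp add: powr_divide powr_minus_divide)
    also have "2 powr (- (2 * b)) \<le> 2 powr (1::real)"
      using b by (intro powr_mono) auto
    finally have "norm (\<phi> (norm u) *\<^sub>R u - \<phi> (norm v) *\<^sub>R v)
        \<le> 2 * d powr (2 * b) * d + 2 * d powr (2 * b) * d"
      using d by (auto simp: mult_right_mono)
    then show ?thesis
      using d by (simp add: powr_add mult.commute flip: d_def)
  qed simp
  show ?thesis
    using main[of u v] main[of v u] by (cases "norm u \<le> norm v") (auto simp: norm_minus_commute)
qed

section \<open>The functions and their augmented Hessians\<close>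

text \<open>
Only the two distinguished coordinate directions \<open>p\<close> and \<open>q\<close> matter, so the enumeration of the index type
is replaced by this pair. The remaining coordinates form the vector \<open>y x\<close>, whose norm is \<open>\<eta>\<close>;
\<open>a\<close> is \<open>\<alpha> / 2\<close>, \<open>r\<close> is \<open>\<epsilon>\<^sup>2 + \<eta>\<^sup>2\<close>, and \<open>t\<close> is the power of \<open>r\<close> with exponent \<open>a\<close>.
\<close>

locale two_axes =
  fixes p q :: "'n::finite"
  assumes pq: "p \<noteq> q" and card3: "CARD('n) \<ge> 3"
begin

abbreviation y :: "real ^ 'n \<Rightarrow> real ^ 'n" where "y \<equiv> off_axes p q"

definition a :: real where "a = 1 - 1 / real CARD('n)"

definition r :: "real \<Rightarrow> real ^ 'n \<Rightarrow> real" where "r \<epsilon> x = \<epsilon>\<^sup>2 + y x \<bullet> y x"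

definition t :: "real \<Rightarrow> real ^ 'n \<Rightarrow> real" where "t \<epsilon> x = r \<epsilon> x powr a"

definition P :: "real ^ 'n \<Rightarrow> real" where "P x = 1 + (x $ p)\<^sup>2"
definition Q :: "real ^ 'n \<Rightarrow> real" where "Q x = 1 + (x $ q)\<^sup>2"

definition z_split :: "real \<Rightarrow> real ^ 'n \<Rightarrow> real" where "z_split \<epsilon> x = P x * Q x * t \<epsilon> x"

lemma a_bounds: "2/3 \<le> a" "a < 1"
  using card3 by (auto simp: a_def field_simps)

lemma r_pos: "\<epsilon> > 0 \<Longrightarrow> r \<epsilon> x > 0"
  by (simp add: r_def add_pos_nonneg)

lemma y_le: "y x \<bullet> y x \<le> x \<bullet> x"
  by (auto simp: inner_vec_def off_axes_def intro!: sum_mono)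

lemma bounded_linear_y: "bounded_linear y"
  unfolding linear_conv_bounded_linear[symmetric]
  by (rule linearI) (auto simp: off_axes_def vec_eq_iff)

lemma r_has_derivative: "(r \<epsilon> has_derivative (\<lambda>h. 2 * (y x \<bullet> y h))) (at x)"
  unfolding r_def
  by (auto intro!: derivative_eq_intros bounded_linear.has_derivative[OF bounded_linear_y]
      simp: inner_commute)

lemma partial_r: "partial i (r \<epsilon>) = (\<lambda>x. 2 * y x $ i)"
proof
  fix x
  have "y (axis i 1) = (if i = p \<or> i = q then 0 else axis i 1)"
    by (auto simp: off_axes_def vec_eq_iff axis_def)
  then show "partial i (r \<epsilon>) x = 2 * y x $ i"
    using partial_eqI[OF r_has_derivative] by (auto simp: inner_axis off_axes_def)
qed

lemma smooth_y: "smooth_on UNIV (\<lambda>x. y x $ i)"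
  by (cases "i = p \<or> i = q") (auto simp: off_axes_def smooth_on_const smooth_on_coord)

lemma partial_y: "partial i (\<lambda>x. y x $ j) = (\<lambda>x. if i = j \<and> j \<noteq> p \<and> j \<noteq> q then 1 else 0)"
  by (cases "j = p \<or> j = q") (auto simp: off_axes_def partial_coord)

lemma smooth_r: "smooth_on UNIV (r \<epsilon>)"
proof (rule smooth_onI_partial)
  show "r \<epsilon> differentiable at x" for x
    using r_has_derivative differentiable_def by blast
  show "smooth_on UNIV (partial i (r \<epsilon>))" for i
    by (simp add: partial_r smooth_on_mult smooth_on_const smooth_y)
qed

lemma smooth_r_powr: "\<epsilon> > 0 \<Longrightarrow> smooth_on UNIV (\<lambda>x. r \<epsilon> x powr c)"
  by (intro smooth_on_powr smooth_r r_pos)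

lemma partial_r_powr:
  "\<epsilon> > 0 \<Longrightarrow> partial i (\<lambda>x. r \<epsilon> x powr c) x = 2 * c * y x $ i * r \<epsilon> x powr (c - 1)"
  by (simp add: partial_powr smooth_on_differentiable smooth_r r_pos partial_r)

lemma smooth_t: "\<epsilon> > 0 \<Longrightarrow> smooth_on UNIV (t \<epsilon>)"
  unfolding t_def[abs_def] by (rule smooth_r_powr)

lemma t_pos: "\<epsilon> > 0 \<Longrightarrow> t \<epsilon> x > 0"
  using r_pos[of \<epsilon> x] by (simp add: t_def)

lemma r_powr_shift:
  assumes "\<epsilon> > 0"
  shows "r \<epsilon> x powr (a - 1) = t \<epsilon> x / r \<epsilon> x" "r \<epsilon> x powr (a - 1 - 1) = t \<epsilon> x / (r \<epsilon> x)\<^sup>2"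
    "r \<epsilon> x powr (a - 2) = t \<epsilon> x / (r \<epsilon> x)\<^sup>2"
  using r_pos[OF assms, of x] by (auto simp: t_def powr_diff power2_eq_square)

lemma partial_t: "\<epsilon> > 0 \<Longrightarrow> partial i (t \<epsilon>) = (\<lambda>x. 2 * a * y x $ i * r \<epsilon> x powr (a - 1))"
  unfolding t_def[abs_def] by (simp add: partial_r_powr fun_eq_iff)

lemma partial_partial_t:
  assumes "\<epsilon> > 0"
  shows "partial i (partial j (t \<epsilon>)) x = 2 * a * (if i = j \<and> j \<noteq> p \<and> j \<noteq> q then 1 else 0) * (t \<epsilon> x / r \<epsilon> x)
     + 4 * a * (a - 1) * y x $ i * y x $ j * (t \<epsilon> x / (r \<epsilon> x)\<^sup>2)"
  using assms
  by (simp add: partial_t partial_mult partial_r_powr smooth_on_differentiable smooth_r_powr smooth_y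
      smooth_on_mult smooth_on_const partial_y)
    (auto simp: r_powr_shift algebra_simps diff_divide_distrib)

lemma smooth_P: "smooth_on UNIV P" and smooth_Q: "smooth_on UNIV Q"
  unfolding P_def[abs_def] Q_def[abs_def] power2_eq_square
  by (intro smooth_on_add smooth_on_mult smooth_on_const smooth_on_coord)+

lemma partial_square_coord: "partial i (\<lambda>x. 1 + (x $ k)\<^sup>2) = (\<lambda>x. if i = k then 2 * x $ k else 0)"
  unfolding power2_eq_square
  by (auto simp: fun_eq_iff partial_add partial_mult smooth_on_differentiable smooth_on_mult
      smooth_on_const smooth_on_coord partial_coord)

lemma partial_P: "partial i P = (\<lambda>x. if i = p then 2 * x $ p else 0)"
  and partial_Q: "partial i Q = (\<lambda>x. if i = q then 2 * x $ q else 0)"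
  unfolding P_def[abs_def] Q_def[abs_def] by (rule partial_square_coord)+

lemma smooth_z_split: "\<epsilon> > 0 \<Longrightarrow> smooth_on UNIV (z_split \<epsilon>)"
  unfolding z_split_def[abs_def] by (intro smooth_on_mult smooth_P smooth_Q smooth_t)

lemma partial_z_split:
  assumes "\<epsilon> > 0"
  shows "partial i (z_split \<epsilon>) = (if i = p then (\<lambda>x. 2 * x$p * (Q x * t \<epsilon> x))
      else if i = q then (\<lambda>x. 2 * x$q * (P x * t \<epsilon> x))
      else (\<lambda>x. 2 * a * (P x * Q x * (y x $ i * r \<epsilon> x powr (a - 1)))))"
  unfolding z_split_def[abs_def]
  using pq assms
  by (auto simp: fun_eq_iff partial_mult smooth_on_differentiable smooth_P smooth_Q smooth_t
      smooth_on_mult partial_P partial_Q partial_t)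
    (auto simp: off_axes_def)

text \<open>
The entries of the augmented Hessian, without the powers of \<open>r\<close>. Their only dependence on \<open>\<epsilon>\<close> is
through \<open>t\<close>, so they stay bounded; the factor \<open>s\<close> marks the contribution of the gradient.
\<close>

definition A11 where "A11 s \<epsilon> x = 2 * Q x + s * (4 * (x$p)\<^sup>2 * (Q x)\<^sup>2 * t \<epsilon> x)"
definition A22 where "A22 s \<epsilon> x = 2 * P x + s * (4 * (x$q)\<^sup>2 * (P x)\<^sup>2 * t \<epsilon> x)"
definition A12 where "A12 s \<epsilon> x = 4 * x$p * x$q + s * (4 * x$p * x$q * P x * Q x * t \<epsilon> x)"
definition B1 where "B1 s \<epsilon> x = 4 * a * x$p * Q x + s * (4 * a * x$p * P x * (Q x)\<^sup>2 * t \<epsilon> x)"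
definition B2 where "B2 s \<epsilon> x = 4 * a * x$q * P x + s * (4 * a * x$q * (P x)\<^sup>2 * Q x * t \<epsilon> x)"
definition g where "g x = 2 * a * (P x * Q x)"
definition h where
  "h s \<epsilon> x = 4 * a * (a - 1) * (P x * Q x) + s * (4 * a\<^sup>2 * (P x)\<^sup>2 * (Q x)\<^sup>2 * t \<epsilon> x)"

text \<open>
The singular factors are explicit: \<open>t\<close> in the block of \<open>p\<close> and \<open>q\<close>, \<open>t / r\<close> on the borders and on the
diagonal of the rest, and \<open>t / r\<^sup>2\<close> in front of \<open>y \<otimes> y\<close>.
\<close>

lemma aug_hessian_z_split:
  assumes e: "\<epsilon> > 0"
  shows "aug_hessian s (z_split \<epsilon>) x = bordered p q (y x)
    (t \<epsilon> x * A11 s \<epsilon> x) (t \<epsilon> x * A22 s \<epsilon> x) (t \<epsilon> x * A12 s \<epsilon> x)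
    (t \<epsilon> x / r \<epsilon> x * B1 s \<epsilon> x) (t \<epsilon> x / r \<epsilon> x * B2 s \<epsilon> x)
    (t \<epsilon> x / r \<epsilon> x * g x) (t \<epsilon> x / (r \<epsilon> x)\<^sup>2 * h s \<epsilon> x)" (is "_ = ?M")
proof -
  note sm = smooth_on_differentiable smooth_P smooth_Q smooth_t[OF e] smooth_r_powr[OF e]
      smooth_on_mult smooth_on_coord smooth_on_const smooth_y
  note pt = partial_P partial_Q partial_t[OF e] partial_mult partial_coord
      partial_r_powr[OF e] partial_y
  note ds = A11_def A22_def A12_def B1_def B2_def g_def h_def
  have yp: "y x $ p = 0" "y x $ q = 0" by (simp_all add: off_axes_def)
  have r0: "r \<epsilon> x \<noteq> 0" using r_pos[OF e] by (metis less_irrefl)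
  have "aug_hessian s (z_split \<epsilon>) x $ i $ j = ?M $ i $ j" for i j
  proof -
    have E: "aug_hessian s (z_split \<epsilon>) x $ i $ j
        = partial i (partial j (z_split \<epsilon>)) x + s * (partial i (z_split \<epsilon>) x * partial j (z_split \<epsilon>) x)"
      by (simp add: aug_hessian_def hessian_def tensor_def grad_def)
    consider "i = p" | "i = q" | "i \<noteq> p" "i \<noteq> q" by blast
    then show ?thesis
    proof cases
      case 1
      consider "j = p" | "j = q" | "j \<noteq> p" "j \<noteq> q" by blast
      then show ?thesis
        unfolding E using 1 pq r0 by cases (simp_all add: partial_z_split[OF e] pt sm bordered_def,
          simp_all add: ds yp r_powr_shift[OF e] field_simps power2_eq_square)
    next
      case 2
      consider "j = p" | "j = q" | "j \<noteq> p" "j \<noteq> q" by blast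
      then show ?thesis
        unfolding E using 2 pq r0 by cases (simp_all add: partial_z_split[OF e] pt sm bordered_def,
          simp_all add: ds yp r_powr_shift[OF e] field_simps power2_eq_square)
    next
      case 3
      consider "j = p" | "j = q" | "j \<noteq> p" "j \<noteq> q" "i = j" | "j \<noteq> p" "j \<noteq> q" "i \<noteq> j" by blast
      then show ?thesis
        unfolding E using 3 pq r0 by cases (simp_all add: partial_z_split[OF e] pt sm bordered_def,
          simp_all add: ds yp r_powr_shift[OF e] field_simps power2_eq_square)
    qed
  qed
  then show ?thesis by (simp add: vec_eq_iff)
qed

section \<open>Uniform bounds for the factors\<close>

lemma weight_bounds:
  assumes "0 < \<epsilon>" "\<epsilon> < 1" "norm x < 1"
  shows "0 < r \<epsilon> x" "r \<epsilon> x \<le> 2" "\<epsilon>\<^sup>2 \<le> r \<epsilon> x" "0 < t \<epsilon> x" "t \<epsilon> x \<le> 2" "\<bar>y x $ i\<bar> \<le> 1"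
    "\<bar>y x $ i\<bar> \<le> sqrt (r \<epsilon> x)"
proof -
  have n: "y x \<bullet> y x \<le> 1"
    using y_le[of x] assms(3) by (metis norm_eq_sqrt_inner less_imp_le order_trans real_sqrt_le_1_iff)
  show r: "0 < r \<epsilon> x" using r_pos assms by blast
  show r2: "r \<epsilon> x \<le> 2" using n assms(1,2) power_le_one[of \<epsilon> 2] by (simp add: r_def)
  show "\<epsilon>\<^sup>2 \<le> r \<epsilon> x" by (simp add: r_def)
  show "0 < t \<epsilon> x" using t_pos assms by blast
  have "t \<epsilon> x \<le> 2 powr a" unfolding t_def using r r2 a_bounds by (intro powr_mono2) auto
  also have "\<dots> \<le> 2 powr 1" using a_bounds by (intro powr_mono) auto
  finally show "t \<epsilon> x \<le> 2" by simp
  have c: "\<bar>y x $ i\<bar> \<le> sqrt (y x \<bullet> y x)"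
    using component_le_norm_cart[of "y x" i] by (simp add: norm_eq_sqrt_inner)
  show "\<bar>y x $ i\<bar> \<le> 1"
    using c n by (metis order_trans real_sqrt_le_1_iff)
  show "\<bar>y x $ i\<bar> \<le> sqrt (r \<epsilon> x)"
    by (rule order_trans[OF c]) (simp add: r_def)
qed

lemma bounded_r: "unif_bounded r"
  by (rule unif_boundedI[of _ 2]) (auto simp: weight_bounds abs_of_pos)

lemma bounded_y_G: "unif_bounded (\<lambda>\<epsilon> x. y x $ i * r \<epsilon> x powr (a - 1))"
proof (rule unif_boundedI)
  fix \<epsilon> :: real and x :: "real ^ 'n" assume e: "0 < \<epsilon>" "\<epsilon> < 1" "norm x < 1"
  note w = weight_bounds[OF e]
  have "\<bar>y x $ i * r \<epsilon> x powr (a - 1)\<bar> \<le> sqrt (r \<epsilon> x) * r \<epsilon> x powr (a - 1)"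
    using w(7)[of i] by (simp add: abs_mult mult_right_mono)
  also have "\<dots> = r \<epsilon> x powr (a - 1/2)"
    using w(1) by (simp add: powr_half_sqrt[symmetric] flip: powr_add)
  also have "\<dots> \<le> 2 powr (a - 1/2)"
    using w(1,2) a_bounds by (intro powr_mono2) auto
  finally show "\<bar>y x $ i * r \<epsilon> x powr (a - 1)\<bar> \<le> 2 powr (a - 1/2)" .
qed

text \<open>
Two derivatives of \<open>t\<close> cost at most a factor \<open>r\<close>: both terms of the second derivative are at most a multiple of
\<open>t / r\<close> because \<open>\<bar>y\<^sub>i\<bar> \<le> sqrt r\<close>. The gradient is bounded since \<open>a \<ge> 1/2\<close>.
\<close>

lemma weighted_C2_t: "weighted_C2 r t"
proof (rule weighted_C2I)
  show "smooth_on UNIV (t \<epsilon>)" if "\<epsilon> > 0" for \<epsilon> using smooth_t that .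
  show "unif_bounded t"
    by (rule unif_boundedI[of _ 2]) (auto simp: weight_bounds abs_of_pos)
  show "unif_bounded (\<lambda>\<epsilon>. partial i (t \<epsilon>))" for i
    by (rule unif_bounded_cong[THEN iffD2, OF _
          unif_bounded_mult[OF unif_bounded_const[of "2 * a"] bounded_y_G[of i]]])
      (simp add: partial_t)
  show "unif_bounded (\<lambda>\<epsilon> x. r \<epsilon> x * partial i (partial j (t \<epsilon>)) x)" for i j
  proof (rule unif_boundedI)
    fix \<epsilon> :: real and x :: "real ^ 'n" assume e: "0 < \<epsilon>" "\<epsilon> < 1" "norm x < 1"
    note w = weight_bounds[OF e]
    define k where "k = (y x $ i * y x $ j) / r \<epsilon> x"
    have "\<bar>y x $ i * y x $ j\<bar> \<le> sqrt (r \<epsilon> x) * sqrt (r \<epsilon> x)"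
      unfolding abs_mult using w by (intro mult_mono) auto
    then have k: "\<bar>k\<bar> \<le> 1" using w(1) by (simp add: k_def)
    define m :: real where "m = (if i = j \<and> j \<noteq> p \<and> j \<noteq> q then 1 else 0)"
    have m: "\<bar>m\<bar> \<le> 1" by (simp add: m_def)
    have "r \<epsilon> x * partial i (partial j (t \<epsilon>)) x = (2 * a * m + 4 * a * (a - 1) * k) * t \<epsilon> x"
      using w(1) by (simp add: partial_partial_t e k_def power2_eq_square field_simps flip: m_def)
    also have "\<bar>\<dots>\<bar> \<le> (2 + 4) * 2"
    proof -
      have "\<bar>2 * a * m\<bar> \<le> 2" using m a_bounds by (simp add: abs_mult mult_le_one)
      moreover have "\<bar>4 * a * (a - 1) * k\<bar> \<le> 4"
        using k a_bounds by (simp add: abs_mult mult_le_one)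
      ultimately show ?thesis
        unfolding abs_mult[of _ "t \<epsilon> x"] using w(4,5) by (intro mult_mono) linarith+
    qed
    finally show "\<bar>r \<epsilon> x * partial i (partial j (t \<epsilon>)) x\<bar> \<le> (2 + 4) * 2" .
  qed
qed

lemma weighted_C2_r: "weighted_C2 (\<lambda>_ _. 1) r"
proof (rule weighted_C2I)
  show "smooth_on UNIV (r \<epsilon>)" for \<epsilon> by (rule smooth_r)
  show "unif_bounded r" by (rule bounded_r)
  show "unif_bounded (\<lambda>\<epsilon>. partial i (r \<epsilon>))" for i
    unfolding partial_r
    by (intro unif_bounded_mult unif_bounded_const unif_boundedI[of "\<lambda>_ x. y x $ i" 1]
        weight_bounds)
  show "unif_bounded (\<lambda>\<epsilon> x. 1 * partial i (partial j (r \<epsilon>)) x)" for i j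
    by (simp add: partial_r partial_mult partial_y smooth_on_differentiable smooth_on_const smooth_y)
      (simp add: unif_bounded_const)
qed

lemmas weighted_C2_intros = weighted_C2_add weighted_C2_mult[OF bounded_r]
  weighted_C2_power[OF bounded_r] weighted_C2_diff[OF bounded_r]
  weighted_C2_const unif_bounded_const weighted_C2_coord weighted_C2_t

lemma weighted_C2_P: "weighted_C2 r (\<lambda>_. P)" and weighted_C2_Q: "weighted_C2 r (\<lambda>_. Q)"
  unfolding P_def[abs_def] Q_def[abs_def] by (intro weighted_C2_intros)+

lemma weighted_C2_z_split: "weighted_C2 r z_split"
  unfolding z_split_def[abs_def] by (intro weighted_C2_intros weighted_C2_P weighted_C2_Q)

lemma weighted_C2_coefficients:
  "weighted_C2 r (A11 s)" "weighted_C2 r (A12 s)" "weighted_C2 r (A22 s)"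
  "weighted_C2 r (B1 s)" "weighted_C2 r (B2 s)" "weighted_C2 r (\<lambda>_. g)" "weighted_C2 r (h s)"
  unfolding A11_def[abs_def] A12_def[abs_def] A22_def[abs_def] B1_def[abs_def] B2_def[abs_def]
    g_def[abs_def] h_def[abs_def]
  by (intro weighted_C2_intros weighted_C2_P weighted_C2_Q)+

section \<open>Uniform Hoelder bounds for the gradient\<close>

lemma holder_y_G: "unif_holder (2 * a - 1) (\<lambda>\<epsilon> x. y x $ i * r \<epsilon> x powr (a - 1))"
  unfolding unif_holder_def
proof (intro exI[of _ 4] ballI)
  fix \<epsilon> :: real and v w :: "real ^ 'n" assume e: "\<epsilon> \<in> {0<..<1}"
  let ?\<phi> = "\<lambda>v. (\<epsilon>\<^sup>2 + (norm (y v))\<^sup>2) powr (a - 1)"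
  have r: "r \<epsilon> v = \<epsilon>\<^sup>2 + (norm (y v))\<^sup>2" for v by (simp add: r_def power2_norm_eq_inner)
  have "\<bar>y v $ i * r \<epsilon> v powr (a - 1) - y w $ i * r \<epsilon> w powr (a - 1)\<bar>
      = \<bar>(?\<phi> v *\<^sub>R y v - ?\<phi> w *\<^sub>R y w) $ i\<bar>"
    by (simp add: r mult.commute)
  also have "\<dots> \<le> norm (?\<phi> v *\<^sub>R y v - ?\<phi> w *\<^sub>R y w)"
    by (rule component_le_norm_cart)
  also have "\<dots> \<le> 4 * norm (y v - y w) powr (2 * (a - 1) + 1)"
    using e a_bounds by (intro weighted_power_holder) auto
  also have "\<dots> \<le> 4 * norm (v - w) powr (2 * (a - 1) + 1)"
  proof -
    have "y v - y w = y (v - w)"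
      using bounded_linear_y by (simp add: linear_simps)
    then have "norm (y v - y w) \<le> norm (v - w)"
      using y_le[of "v - w"] by (simp add: norm_eq_sqrt_inner)
    then show ?thesis
      using a_bounds by (intro mult_left_mono powr_mono2) auto
  qed
  finally show "\<bar>y v $ i * r \<epsilon> v powr (a - 1) - y w $ i * r \<epsilon> w powr (a - 1)\<bar>
      \<le> 4 * norm (v - w) powr (2 * a - 1)"
    by (simp add: algebra_simps)
qed

text \<open>
The exponent \<open>2 a - 1\<close> is \<open>1 - 2 / n\<close>. In the directions \<open>p\<close> and \<open>q\<close> the derivatives are even Lipschitz;
in the others the regularised power appears.
\<close>

lemma holder_partial_z_split: "unif_holder (2 * a - 1) (\<lambda>\<epsilon>. partial i (z_split \<epsilon>))"
proof -
  have \<beta>: "0 < 2 * a - 1" "2 * a - 1 \<le> 1" using a_bounds by auto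
  let ?G = "\<lambda>\<epsilon> x. if i = p then 2 * x$p * (Q x * t \<epsilon> x)
      else if i = q then 2 * x$q * (P x * t \<epsilon> x)
      else 2 * a * (P x * Q x * (y x $ i * r \<epsilon> x powr (a - 1)))"
  have *: "unif_holder (2 * a - 1) (\<lambda>\<epsilon> x. 2 * x$p * (Q x * t \<epsilon> x))"
     "unif_holder (2 * a - 1) (\<lambda>\<epsilon> x. 2 * x$q * (P x * t \<epsilon> x))"
    by (rule weighted_C2_imp_holder[OF _ \<beta>, of r],
        intro weighted_C2_intros weighted_C2_P weighted_C2_Q)+
  have PQ: "weighted_C2 r (\<lambda>_ x. 2 * a * (P x * Q x))"
    by (intro weighted_C2_intros weighted_C2_P weighted_C2_Q)
  have "unif_holder (2 * a - 1) (\<lambda>\<epsilon> x. 2 * a * (P x * Q x) * (y x $ i * r \<epsilon> x powr (a - 1)))"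
    by (intro unif_holder_mult weighted_C2_imp_holder[OF PQ \<beta>] weighted_C2D(2)[OF PQ]
        holder_y_G bounded_y_G)
  then have "unif_holder (2 * a - 1) ?G" 
    using * by (cases "i = p"; cases "i = q"; simp add: mult.assoc)
  then show ?thesis
    unfolding unif_holder_def by (simp add: partial_z_split if_distribR cong: if_cong)
qed

lemma z_split_C1_holder:
  assumes "S \<subseteq> ball 0 1"
  shows "\<exists>C::real. \<forall>\<epsilon>\<in>{0<..<1}. C1_holder_norm (2 * a - 1) S (z_split \<epsilon>) \<le> ennreal C"
  by (intro C1_holder_norm_bounded assms weighted_C2D[OF weighted_C2_z_split] holder_partial_z_split)

section \<open>The determinant\<close>

text \<open>
The determinant of the \<open>2 \<times> 2\<close> block, and the quadratic expression that the borders contribute to the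
determinant.
\<close>

definition block_det where "block_det s \<epsilon> x = A11 s \<epsilon> x * A22 s \<epsilon> x - (A12 s \<epsilon> x)\<^sup>2"
definition border_form where "border_form s \<epsilon> x = A11 s \<epsilon> x * (B2 s \<epsilon> x)\<^sup>2
   - 2 * A12 s \<epsilon> x * B1 s \<epsilon> x * B2 s \<epsilon> x + A22 s \<epsilon> x * (B1 s \<epsilon> x)\<^sup>2"

text \<open>
The value of the determinant, arranged so that every term carries one of the factors \<open>r\<close> and
\<open>\<epsilon>\<^sup>2\<close>, both of which are smooth and dominated by the weight \<open>r\<close>.
\<close>

definition det_value where "det_value s \<epsilon> x =
    r \<epsilon> x * (g x ^ (CARD('n) - 3) * (block_det s \<epsilon> x * (g x + h s \<epsilon> x) - border_form s \<epsilon> x))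
    + \<epsilon>\<^sup>2 * (g x ^ (CARD('n) - 3) * (border_form s \<epsilon> x - block_det s \<epsilon> x * h s \<epsilon> x))"

lemma weighted_C2_det_value: "weighted_C2 (\<lambda>_ _. 1) (det_value s)"
proof -
  note I = weighted_C2_intros weighted_C2_coefficients
  have d: "weighted_C2 r (block_det s)" "weighted_C2 r (border_form s)"
    unfolding block_det_def[abs_def] border_form_def[abs_def] by (intro I)+
  have e: "weighted_C2 (\<lambda>_ _. 1) (\<lambda>\<epsilon> (x :: real ^ 'n). \<epsilon>\<^sup>2)"
    by (rule weighted_C2_const, rule unif_boundedI[of _ 1]) (simp add: power_le_one)
  show ?thesis
    unfolding det_value_def[abs_def]
    by (intro weighted_C2_add weighted_C2_gain[where \<omega> = r, OF _ weighted_C2_r]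
        weighted_C2_gain[where \<omega> = r, OF _ e] I d)
      (auto simp: weight_bounds abs_of_pos)
qed

text \<open>
This is the identity that fixes the exponent \<open>\<alpha>\<close>: \<open>a n = n - 1\<close>.
\<close>

lemma t_power: "\<epsilon> > 0 \<Longrightarrow> t \<epsilon> x ^ CARD('n) = r \<epsilon> x ^ (CARD('n) - 1)"
proof -
  assume "\<epsilon> > 0"
  note r = r_pos[OF this, of x]
  have "t \<epsilon> x ^ CARD('n) = r \<epsilon> x powr (a * real CARD('n))"
    using r by (simp add: t_def powr_powr flip: powr_realpow)
  also have "a * real CARD('n) = real (CARD('n) - 1)"
    using card3 by (simp add: a_def field_simps of_nat_diff)
  finally show ?thesis by (simp only: powr_realpow[OF r])
qed

text \<open>
The powers of \<open>t\<close> and \<open>r\<close> in the determinant of the bordered matrix collect to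
the single factor \<open>t\<^sup>n / r\<^sup>n\<^sup>-\<^sup>1\<close>, which is one by the choice of the exponent.
\<close>

lemma det_aug_hessian:
  assumes e: "\<epsilon> > 0" and pd: "A11 s \<epsilon> x \<noteq> 0" "block_det s \<epsilon> x \<noteq> 0"
  shows "det (aug_hessian s (z_split \<epsilon>) x) = det_value s \<epsilon> x"
proof -
  define \<tau> \<rho> where "\<tau> = t \<epsilon> x" and "\<rho> = r \<epsilon> x"
  have pos: "\<tau> > 0" "\<rho> > 0" using t_pos[OF e] r_pos[OF e] by (auto simp: \<tau>_def \<rho>_def)
  obtain k where k: "CARD('n) = k + 3" using card3 by (metis add.commute le_Suc_ex)
  have yy: "y x \<bullet> y x = \<rho> - \<epsilon>\<^sup>2" by (simp add: \<rho>_def r_def)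
  have g: "g x > 0"
    using a_bounds by (simp add: g_def P_def Q_def add_pos_nonneg)
  have "det (aug_hessian s (z_split \<epsilon>) x)
    = (\<tau> / \<rho> * g x) ^ k * ((\<tau> * A11 s \<epsilon> x * (\<tau> * A22 s \<epsilon> x) - (\<tau> * A12 s \<epsilon> x)\<^sup>2)
        * (\<tau> / \<rho> * g x + \<tau> / \<rho>\<^sup>2 * h s \<epsilon> x * (\<rho> - \<epsilon>\<^sup>2))
      - (\<rho> - \<epsilon>\<^sup>2) * (\<tau> * A11 s \<epsilon> x * (\<tau> / \<rho> * B2 s \<epsilon> x)\<^sup>2
        - 2 * (\<tau> * A12 s \<epsilon> x) * (\<tau> / \<rho> * B1 s \<epsilon> x) * (\<tau> / \<rho> * B2 s \<epsilon> x)
        + \<tau> * A22 s \<epsilon> x * (\<tau> / \<rho> * B1 s \<epsilon> x)\<^sup>2))"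
  proof -
    have nz: "\<tau> * A11 s \<epsilon> x * (\<tau> * A22 s \<epsilon> x) - (\<tau> * A12 s \<epsilon> x)\<^sup>2 = \<tau>\<^sup>2 * block_det s \<epsilon> x"
      by (simp add: block_det_def algebra_simps power2_eq_square)
    show ?thesis
      unfolding aug_hessian_z_split[OF e] yy[symmetric]
      by (subst det_bordered)
        (use pq pos pd g nz k in \<open>auto simp: \<tau>_def \<rho>_def off_axes_def\<close>)
  qed
  also have "\<dots> = (\<tau> / \<rho> * g x) ^ k * (\<tau> ^ 3 / \<rho>\<^sup>2 *
      (\<rho> * (block_det s \<epsilon> x * (g x + h s \<epsilon> x) - border_form s \<epsilon> x)
        + \<epsilon>\<^sup>2 * (border_form s \<epsilon> x - block_det s \<epsilon> x * h s \<epsilon> x)))"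
    using pos by (simp add: block_det_def border_form_def field_simps power2_eq_square power3_eq_cube)
  also have "\<dots> = \<tau> ^ CARD('n) / \<rho> ^ (CARD('n) - 1) * det_value s \<epsilon> x"
    using pos unfolding k det_value_def
    by (simp add: k power_add power_mult_distrib power_divide \<rho>_def[symmetric] field_simps
        power2_eq_square power3_eq_cube)
  also have "\<tau> ^ CARD('n) / \<rho> ^ (CARD('n) - 1) = 1"
    using t_power[OF e, of x] pos by (simp add: \<tau>_def \<rho>_def)
  finally show ?thesis by simp
qed

section \<open>Positive definiteness\<close>

text \<open>
With both \<open>\<epsilon>\<close> and the radius below \<open>1/100\<close>, \<open>r\<close> is at most \<open>2 / 10000 < 1 / 4900\<close>; the exponent \<open>a\<close> is at
least \<open>1/2\<close>, so that \<open>t \<le> sqrt r\<close>.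
\<close>

lemma small_ball_bounds:
  assumes "0 < \<epsilon>" "\<epsilon> < 1/100" "norm x < 1/100"
  shows "t \<epsilon> x \<le> 1/70" "\<bar>x $ i\<bar> \<le> 1/100" "1 \<le> P x" "P x \<le> 1001/1000" "1 \<le> Q x" "Q x \<le> 1001/1000"
proof -
  show c: "\<bar>x $ i\<bar> \<le> 1/100" for i
    using component_le_norm_cart[of x i] assms(3) by linarith
  have hundred: "(1/100)\<^sup>2 = (1/10000 :: real)" by (simp add: power2_eq_square)
  have sq: "(x $ i)\<^sup>2 \<le> 1/10000" for i
    using power_mono[OF c[of i] abs_ge_zero, of 2] by (simp add: hundred)
  show "1 \<le> P x" "P x \<le> 1001/1000" "1 \<le> Q x" "Q x \<le> 1001/1000"
    using sq[of p] sq[of q] by (simp_all add: P_def Q_def)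
  have r: "0 < r \<epsilon> x" using r_pos assms by blast
  have "x \<bullet> x \<le> (1/100)\<^sup>2"
    using assms(3) by (metis power2_norm_eq_inner norm_ge_zero power_mono less_imp_le)
  moreover have "\<epsilon>\<^sup>2 \<le> (1/100)\<^sup>2" using assms by (intro power_mono) auto
  ultimately have r2: "r \<epsilon> x \<le> (1/70)\<^sup>2"
    using y_le[of x] unfolding r_def hundred by (simp add: power_divide)
  have "t \<epsilon> x \<le> r \<epsilon> x powr (1/2)"
    unfolding t_def using r r2 a_bounds by (intro powr_mono') (auto simp: power2_eq_square)
  also have "\<dots> \<le> 1/70"
    using r real_sqrt_le_mono[OF r2] by (simp add: powr_half_sqrt)
  finally show "t \<epsilon> x \<le> 1/70" .
qed

text \<open>
Without the terms that contain \<open>t\<close>, the form at the origin is \<open>2 (k\<^sup>2 + l\<^sup>2) + 2 a (\<omega> - 2 (1 - a) \<xi>\<^sup>2)\<close>, and \<open>2 (1 - a) = 2 / n \<le> 2/3\<close>; here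
\<open>n \<ge> 3\<close> enters. The other coefficients are small near the origin, and so is the contribution of
the gradient, which contains a factor \<open>t\<close> in each entry.
\<close>

lemma quadratic_form_lower_bound:
  assumes e: "0 < \<epsilon>" "\<epsilon> < 1/100" "norm x < 1/100" and s: "s = 1 \<or> s = -1" and \<xi>: "\<xi>\<^sup>2 \<le> \<omega>"
  shows "k\<^sup>2 + l\<^sup>2 + \<omega> / 10 \<le> A11 s \<epsilon> x * k\<^sup>2 + 2 * A12 s \<epsilon> x * k * l + A22 s \<epsilon> x * l\<^sup>2
    + 2 * \<xi> * (B1 s \<epsilon> x * k + B2 s \<epsilon> x * l) + g x * \<omega> + h s \<epsilon> x * \<xi>\<^sup>2"
proof -
  note b = small_ball_bounds[OF e]
  note a = a_bounds
  have t: "0 < t \<epsilon> x" using e t_pos by blast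
  define w where "w = P x * Q x"
  have w: "1 \<le> w" "w \<le> 101/100"
    unfolding w_def using b mult_mono[of 1 "P x" 1 "Q x"]
      mult_mono[of "P x" "1001/1000" "Q x" "1001/1000"] by auto
  have wt: "0 \<le> w * t \<epsilon> x" "w * t \<epsilon> x \<le> 3/200"
    using w t b(1) mult_mono[of w "101/100" "t \<epsilon> x" "1/70"] by auto
  have sq: "(x $ i)\<^sup>2 \<le> 1/10000" for i
    using power_mono[OF b(2)[of i] abs_ge_zero, of 2] by (simp add: power_divide)
  have A: "19/10 \<le> 2 * X + s * (4 * Y\<^sup>2 * X\<^sup>2 * t \<epsilon> x)"
    if X: "1 \<le> X" "X \<le> 1001/1000" and Y: "Y\<^sup>2 \<le> 1/10000" for X Y
  proof -
    have "X\<^sup>2 \<le> 2\<^sup>2" using X by (intro power_mono) auto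
    define Z where "Z = 4 * Y\<^sup>2 * X\<^sup>2 * t \<epsilon> x"
    have "Z \<le> 4 * (1/10000) * 2\<^sup>2 * (1/70)"
      unfolding Z_def using Y t b(1) \<open>X\<^sup>2 \<le> 2\<^sup>2\<close> by (intro mult_mono) auto
    moreover have "0 \<le> Z" unfolding Z_def using t by simp
    ultimately show ?thesis unfolding Z_def[symmetric] using s X by auto
  qed
  have A11: "19/10 \<le> A11 s \<epsilon> x" unfolding A11_def by (rule A[OF b(5,6) sq])
  have A22: "19/10 \<le> A22 s \<epsilon> x" unfolding A22_def by (rule A[OF b(3,4) sq])
  have one: "\<bar>1 + s * (w * t \<epsilon> x)\<bar> \<le> 2" using s wt by auto
  have "A12 s \<epsilon> x = 4 * (x$p * x$q) * (1 + s * (w * t \<epsilon> x))"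
    by (simp add: A12_def w_def algebra_simps)
  also have "\<bar>\<dots>\<bar> \<le> 4 * (1/100 * (1/100)) * 2"
    unfolding abs_mult using one b(2) by (intro mult_mono) auto
  finally have A12: "\<bar>A12 s \<epsilon> x\<bar> \<le> 1/10" by simp
  have "B1 s \<epsilon> x = 4 * a * (x$p * Q x) * (1 + s * (w * t \<epsilon> x))"
    by (simp add: B1_def w_def algebra_simps power2_eq_square)
  also have "\<bar>\<dots>\<bar> \<le> 4 * 1 * (1/100 * (1001/1000)) * 2"
    unfolding abs_mult using one b(2) b(5,6) a by (intro mult_mono) auto
  finally have B1: "\<bar>B1 s \<epsilon> x\<bar> \<le> 1/10" by simp
  have "B2 s \<epsilon> x = 4 * a * (x$q * P x) * (1 + s * (w * t \<epsilon> x))"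
    by (simp add: B2_def w_def algebra_simps power2_eq_square)
  also have "\<bar>\<dots>\<bar> \<le> 4 * 1 * (1/100 * (1001/1000)) * 2"
    unfolding abs_mult using one b(2) b(3,4) a by (intro mult_mono) auto
  finally have B2: "\<bar>B2 s \<epsilon> x\<bar> \<le> 1/10" by simp
  \<comment> \<open>the negative part of \<open>h\<close>, for the unfavourable sign of \<open>s\<close>\<close>
  define H where "H = 4 * a * (1 - a) * w + 4 * a\<^sup>2 * w * (w * t \<epsilon> x)"
  have H0: "0 \<le> H" unfolding H_def using a w wt by simp
  have "- H \<le> h s \<epsilon> x"
  proof -
    have "0 \<le> 4 * a\<^sup>2 * w * (w * t \<epsilon> x)" using w wt by simp
    moreover have "h s \<epsilon> x = - (4 * a * (1 - a) * w) + s * (4 * a\<^sup>2 * w * (w * t \<epsilon> x))"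
      by (simp add: h_def w_def algebra_simps power2_eq_square)
    ultimately show ?thesis using s unfolding H_def by auto
  qed
  then have "h s \<epsilon> x * \<xi>\<^sup>2 \<ge> - H * \<xi>\<^sup>2" by (intro mult_right_mono) auto
  moreover have "- H * \<xi>\<^sup>2 \<ge> - H * \<omega>" using \<xi> H0 by (simp add: mult_left_mono)
  moreover have "(g x - H) * \<omega> \<ge> (2/5) * \<omega>"
  proof (rule mult_right_mono)
    have "a * (w * t \<epsilon> x) \<le> 1 * (3/200)" using a wt by (intro mult_mono) auto
    then have "1 - 2 * (1 - a) - 2 * (a * (w * t \<epsilon> x)) \<ge> 3/10" using a by simp
    then have "(2 * (2/3) * 1) * (3/10) \<le> 2 * a * w * (1 - 2 * (1 - a) - 2 * (a * (w * t \<epsilon> x)))"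
      using a w by (intro mult_mono) auto
    also have "\<dots> = g x - H"
      by (simp add: g_def H_def w_def algebra_simps power2_eq_square)
    finally show "2/5 \<le> g x - H" by simp
    show "0 \<le> \<omega>" using \<xi> zero_le_power2[of \<xi>] by linarith
  qed
  ultimately have last: "g x * \<omega> + h s \<epsilon> x * \<xi>\<^sup>2 \<ge> (2/5) * \<omega>"
    by (simp add: algebra_simps)
  have young: "2 * C * u * v \<ge> - (u\<^sup>2 + v\<^sup>2) / 10" if "\<bar>C\<bar> \<le> 1/10" for C u v :: real
  proof -
    have "\<bar>2 * C * u * v\<bar> = 2 * \<bar>C\<bar> * \<bar>u * v\<bar>" by (simp add: abs_mult)
    also have "\<dots> \<le> 2 * (1/10) * \<bar>u * v\<bar>" using that by (intro mult_right_mono) auto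
    also have "2 * \<bar>u * v\<bar> \<le> u\<^sup>2 + v\<^sup>2"
      using sum_squares_bound[of "\<bar>u\<bar>" "\<bar>v\<bar>"] by (simp add: abs_mult)
    then have "2 * (1/10) * \<bar>u * v\<bar> \<le> (u\<^sup>2 + v\<^sup>2) / 10" by simp
    finally show ?thesis by linarith
  qed
  have "19/10 * k\<^sup>2 \<le> A11 s \<epsilon> x * k\<^sup>2" "19/10 * l\<^sup>2 \<le> A22 s \<epsilon> x * l\<^sup>2"
    using mult_right_mono[OF A11] mult_right_mono[OF A22] by simp_all
  moreover have "2 * \<xi> * (B1 s \<epsilon> x * k + B2 s \<epsilon> x * l) = 2 * B1 s \<epsilon> x * \<xi> * k + 2 * B2 s \<epsilon> x * \<xi> * l"
    by (simp add: algebra_simps)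
  moreover have "K + L + W / 10 \<le> a1 + c + a2 + b + G + H"
    if "19/10 * K \<le> a1" "19/10 * L \<le> a2" "b = b1 + b2" "- (K + L) / 10 \<le> c" "- (X + K) / 10 \<le> b1"
      "- (X + L) / 10 \<le> b2" "(2/5) * W \<le> G + H" "X \<le> W" "0 \<le> K" "0 \<le> L" "0 \<le> X"
    for K L W X a1 a2 b b1 b2 c G H :: real
    using that by simp
  ultimately show ?thesis
    using young[OF A12, of k l] young[OF B1, of \<xi> k] young[OF B2, of \<xi> l] last \<xi>
      zero_le_power2[of k] zero_le_power2[of l] zero_le_power2[of \<xi>] by blast
qed

text \<open>
After division by \<open>t\<close> and the substitutions \<open>\<xi> = y \<bullet> v / r\<close> and \<open>\<omega> = \<bar>y v\<bar>\<^sup>2 / r\<close> all coefficients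
of the quadratic form are bounded. The Cauchy-Schwarz inequality and \<open>\<eta>\<^sup>2 \<le> r\<close> give the relation
\<open>\<xi>\<^sup>2 \<le> \<omega>\<close> on which the lower bound rests.
\<close>

lemma pos_definite_aug_hessian:
  assumes e: "0 < \<epsilon>" "\<epsilon> < 1/100" "norm x < 1/100" and s: "s = 1 \<or> s = -1"
  shows "pos_definite (aug_hessian s (z_split \<epsilon>) x)"
  unfolding pos_definite_def
proof (intro conjI allI impI)
  show "transpose (aug_hessian s (z_split \<epsilon>) x) = aug_hessian s (z_split \<epsilon>) x"
    by (simp add: aug_hessian_z_split e transpose_bordered)
  fix v :: "real ^ 'n" assume v: "v \<noteq> 0"
  define \<tau> \<rho> where "\<tau> = t \<epsilon> x" and "\<rho> = r \<epsilon> x"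
  have pos: "\<tau> > 0" "\<rho> > 0" using t_pos r_pos e by (auto simp: \<tau>_def \<rho>_def)
  define \<xi> \<omega> where "\<xi> = (y x \<bullet> y v) / \<rho>" and "\<omega> = (y v \<bullet> y v) / \<rho>"
  have "(y x \<bullet> y v)\<^sup>2 \<le> (y x \<bullet> y x) * (y v \<bullet> y v)" by (rule Cauchy_Schwarz_ineq)
  also have "\<dots> \<le> \<rho> * (y v \<bullet> y v)"
    by (intro mult_right_mono) (auto simp: \<rho>_def r_def)
  finally have \<xi>: "\<xi>\<^sup>2 \<le> \<omega>"
    using pos by (simp add: \<xi>_def \<omega>_def field_simps power2_eq_square)
  have "v \<bullet> (aug_hessian s (z_split \<epsilon>) x *v v) = \<tau> * (A11 s \<epsilon> x * (v$p)\<^sup>2 + 2 * A12 s \<epsilon> x * v$p * v$q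
    + A22 s \<epsilon> x * (v$q)\<^sup>2 + 2 * \<xi> * (B1 s \<epsilon> x * v$p + B2 s \<epsilon> x * v$q) + g x * \<omega> + h s \<epsilon> x * \<xi>\<^sup>2)"
  proof -
    have y0: "y x $ p = 0" "y x $ q = 0" by (simp_all add: off_axes_def)
    show ?thesis
      unfolding aug_hessian_z_split[OF e(1)] bordered_quadratic_form[OF pq y0] \<xi>_def \<omega>_def
        \<tau>_def[symmetric] \<rho>_def[symmetric]
      using pos by (simp add: field_simps power2_eq_square)
  qed
  also have "\<dots> > 0"
  proof -
    have "v$p \<noteq> 0 \<or> v$q \<noteq> 0 \<or> y v \<noteq> 0"
      using v by (auto simp: off_axes_def vec_eq_iff)
    moreover have "\<omega> \<ge> 0" "y v \<noteq> 0 \<Longrightarrow> \<omega> > 0" using pos by (auto simp: \<omega>_def)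
    ultimately have "0 < (v$p)\<^sup>2 + (v$q)\<^sup>2 + \<omega> / 10"
      by (smt (verit) zero_le_power2 zero_less_power2 divide_pos_pos divide_nonneg_pos)
    also note quadratic_form_lower_bound[OF e s \<xi>]
    finally show ?thesis using pos by simp
  qed
  finally show "0 < v \<bullet> (aug_hessian s (z_split \<epsilon>) x *v v)" .
qed

text \<open>
Both pivots are nonzero because the leading block inherits positivity from the quadratic form; the
vector \<open>(- A12, A11)\<close> detects its determinant.
\<close>

lemma det_aug_hessian_ball:
  assumes e: "0 < \<epsilon>" "\<epsilon> < 1/100" "norm x < 1/100" and s: "s = 1 \<or> s = -1"
  shows "det (aug_hessian s (z_split \<epsilon>) x) = det_value s \<epsilon> x"
proof (rule det_aug_hessian[OF e(1)])
  note L = quadratic_form_lower_bound[OF e s, of 0 0, simplified]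
  have A: "A11 s \<epsilon> x > 0" using L[of 1 0] by simp
  then show "A11 s \<epsilon> x \<noteq> 0" by simp
  have "0 < (A12 s \<epsilon> x)\<^sup>2 + (A11 s \<epsilon> x)\<^sup>2" using A by (simp add: add_nonneg_pos)
  also have "\<dots> \<le> A11 s \<epsilon> x * block_det s \<epsilon> x"
    using L[of "- A12 s \<epsilon> x" "A11 s \<epsilon> x"] by (simp add: block_det_def algebra_simps power2_eq_square)
  finally show "block_det s \<epsilon> x \<noteq> 0" by auto
qed

section \<open>Blow-up of the Hessian\<close>

text \<open>
At the origin the Hessian is \<open>t D1 + (t / \<epsilon>\<^sup>2) D2\<close> with fixed diagonal matrices and \<open>D2 \<noteq> 0\<close>, where
\<open>t / \<epsilon>\<^sup>2\<close> is \<open>\<epsilon>\<close> to the negative power \<open>2 a - 2\<close>. Homogeneity and the triangle inequality of the norm are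
enough: the second term dominates the first.
\<close>

lemma hessian_blowup:
  assumes N: "matrix_norm N"
  shows "filterlim (\<lambda>\<epsilon>. N (hessian (z_split \<epsilon>) 0)) at_top (at_right 0)"
proof -
  have N0: "N A = 0 \<longleftrightarrow> A = 0" and Nc: "N (c *\<^sub>R A) = \<bar>c\<bar> * N A" and Nt: "N (A + B) \<le> N A + N B"
    for A B c
    using N unfolding matrix_norm_def by blast+
  have "N (- A) = N A" for A using Nc[of "-1" A] by simp
  then have Nnn: "N A \<ge> 0" for A using Nt[of A "- A"] N0[of 0] by simp
  define D1 D2 :: "real ^ 'n ^ 'n" where
    "D1 = bordered p q 0 2 2 0 0 0 0 0" and "D2 = bordered p q 0 0 0 0 0 0 (2 * a) 0"
  have "\<exists>i. i \<noteq> p \<and> i \<noteq> q"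
  proof (rule ccontr)
    assume "\<not> ?thesis"
    then have "(UNIV :: 'n set) \<subseteq> {p, q}" by auto
    then have "CARD('n) \<le> card {p, q}" by (intro card_mono) auto
    then show False using card3 card_insert_le_m1[of 2 "{q}" p] by simp
  qed
  then obtain i where i: "i \<noteq> p" "i \<noteq> q" by blast
  have "D2 $ i $ i = 2 * a" using i by (simp add: D2_def bordered_def)
  then have "D2 \<noteq> 0" using a_bounds by auto
  then have D2: "N D2 > 0" using N0 Nnn by (metis less_eq_real_def)
  have y0: "y 0 = 0" by (simp add: off_axes_def vec_eq_iff)
  have H: "hessian (z_split \<epsilon>) 0 = t \<epsilon> 0 *\<^sub>R D1 + (t \<epsilon> 0 / \<epsilon>\<^sup>2) *\<^sub>R D2" if "\<epsilon> > 0" for \<epsilon>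
  proof -
    have "hessian (z_split \<epsilon>) 0 = aug_hessian 0 (z_split \<epsilon>) 0" by (simp add: aug_hessian_def)
    also have "\<dots> = t \<epsilon> 0 *\<^sub>R D1 + (t \<epsilon> 0 / \<epsilon>\<^sup>2) *\<^sub>R D2"
      using that
      by (auto simp: aug_hessian_z_split y0 D1_def D2_def bordered_def vec_eq_iff A11_def A22_def A12_def
          B1_def B2_def g_def P_def Q_def r_def)
    finally show ?thesis .
  qed
  have lb: "(t \<epsilon> 0 / \<epsilon>\<^sup>2) * (N D2 - \<epsilon>\<^sup>2 * N D1) \<le> N (hessian (z_split \<epsilon>) 0)" if e: "\<epsilon> > 0" for \<epsilon>
  proof -
    have "N ((t \<epsilon> 0 / \<epsilon>\<^sup>2) *\<^sub>R D2) \<le> N (hessian (z_split \<epsilon>) 0) + N ((- t \<epsilon> 0) *\<^sub>R D1)"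
      using Nt[of "hessian (z_split \<epsilon>) 0" "(- t \<epsilon> 0) *\<^sub>R D1"] by (simp add: H[OF e])
    then show ?thesis
      using t_pos[OF e, of 0] e by (simp add: Nc field_simps del: scaleR_minus_left)
  qed
  have G: "filterlim (\<lambda>\<epsilon>. t \<epsilon> 0 / \<epsilon>\<^sup>2) at_top (at_right 0)"
  proof -
    have "((\<lambda>\<epsilon>::real. \<epsilon> powr (2 - 2 * a)) \<longlongrightarrow> 0 powr (2 - 2 * a)) (at_right 0)"
      by (rule tendsto_powr') (use a_bounds in \<open>auto simp: eventually_at_right_less
          intro!: tendsto_eq_intros exI[of _ 1] simp: eventually_at_filter\<close>)
    then have "filterlim (\<lambda>\<epsilon>::real. inverse (\<epsilon> powr (2 - 2 * a))) at_top (at_right 0)"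
      using a_bounds by (intro filterlim_inverse_at_top) (auto simp: eventually_at_filter)
    moreover have "eventually (\<lambda>\<epsilon>. inverse (\<epsilon> powr (2 - 2 * a)) = t \<epsilon> 0 / \<epsilon>\<^sup>2) (at_right (0::real))"
      unfolding eventually_at_filter
      by (rule always_eventually)
        (auto simp: t_def r_def y0 powr_diff powr_powr powr_numeral[symmetric] field_simps
          simp del: powr_numeral)
    ultimately show ?thesis by (simp add: filterlim_cong)
  qed
  have "((\<lambda>\<epsilon>. N D2 - \<epsilon>\<^sup>2 * N D1) \<longlongrightarrow> N D2) (at_right 0)"
    by (auto intro!: tendsto_eq_intros)
  from filterlim_at_top_mult_tendsto_pos[OF this D2 G]
  have "filterlim (\<lambda>\<epsilon>. (t \<epsilon> 0 / \<epsilon>\<^sup>2) * (N D2 - \<epsilon>\<^sup>2 * N D1)) at_top (at_right 0)" .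
  then show ?thesis
    by (rule filterlim_at_top_mono) (use lb in \<open>auto simp: eventually_at_filter\<close>)
qed

end

section \<open>Failure of the interior estimate\<close>

theorem theorem1p1:
  fixes n :: nat and e :: "nat \<Rightarrow> 'n::finite"
  assumes "n \<ge> 3" and "bij_betw e {1..n} (UNIV :: 'n set)"
  shows "(\<forall>\<epsilon>>0. smooth_on UNIV (z n e \<epsilon>)) \<and>
    (\<exists>\<rho>>0. \<exists>\<epsilon>\<^sub>0>0. \<forall>s\<in>{1, -1}.
      (\<forall>N. matrix_norm N \<longrightarrow>
         filterlim (\<lambda>\<epsilon>. N (hessian (z n e \<epsilon>) 0)) at_top (at_right 0)) \<and>
      (\<exists>C::real. \<forall>\<epsilon>\<in>{0<..<\<epsilon>\<^sub>0}.
         Ck_on 1 (ball 0 \<rho>) (z n e \<epsilon>) \<and>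
         C1_holder_norm (1 - 2 / real n) (ball 0 \<rho>) (z n e \<epsilon>) \<le> ennreal C) \<and>
      (\<exists>C::real. \<forall>\<epsilon>\<in>{0<..<\<epsilon>\<^sub>0}.
         Ck_on 2 (ball 0 \<rho>) (\<lambda>x. det (aug_hessian s (z n e \<epsilon>) x)) \<and>
         C2_norm (ball 0 \<rho>) (\<lambda>x. det (aug_hessian s (z n e \<epsilon>) x)) \<le> ennreal C) \<and>
      (\<forall>\<epsilon>\<in>{0<..<\<epsilon>\<^sub>0}. \<forall>x\<in>ball 0 \<rho>. pos_definite (aug_hessian s (z n e \<epsilon>) x)))"
proof -
  have n: "CARD('n) = n" using bij_betw_same_card[OF assms(2)] by simp
  have inj: "e i = e j \<longleftrightarrow> i = j" if "i \<in> {1..n}" "j \<in> {1..n}" for i j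
    using that assms(2) by (meson bij_betw_def inj_on_eq_iff)
  interpret two_axes "e 1" "e 2"
    by standard (use assms n inj[of 1 2] in auto)
  have inner_y: "y x \<bullet> y x = (eta n e x)\<^sup>2" for x
  proof -
    have "y x \<bullet> y x = (\<Sum>k\<in>{1..n}. (y x $ e k)\<^sup>2)"
      using sum.reindex_bij_betw[OF assms(2), of "\<lambda>i. (y x $ i)\<^sup>2"]
      by (simp add: inner_vec_def power2_eq_square)
    also have "\<dots> = (\<Sum>k\<in>{3..n}. (x $ e k)\<^sup>2)"
      by (rule sum.mono_neutral_cong_right)
        (use assms(1) in \<open>auto simp: off_axes_def inj\<close>)
    finally show ?thesis by (simp add: eta_def sum_nonneg)
  qed
  have z: "z n e = z_split"
    by (intro ext) (simp del: One_nat_def add: z_def z_split_def P_def Q_def t_def r_def a_def inner_y n Let_def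
        diff_divide_distrib)
  have \<beta>: "1 - 2 / real n = 2 * a - 1" by (simp add: a_def n)
  let ?B = "ball 0 (1/100) :: (real ^ 'n) set"
  have B: "?B \<subseteq> ball 0 1" by auto
  obtain C1 where C1: "\<And>\<epsilon>. \<epsilon> \<in> {0<..<1} \<Longrightarrow> C1_holder_norm (2 * a - 1) ?B (z_split \<epsilon>) \<le> ennreal C1"
    using z_split_C1_holder[OF B] by blast
  have det: "Ck_on 2 ?B (\<lambda>x. det (aug_hessian s (z_split \<epsilon>) x)) \<and>
      C2_norm ?B (\<lambda>x. det (aug_hessian s (z_split \<epsilon>) x)) = C2_norm ?B (det_value s \<epsilon>)"
    if "\<epsilon> \<in> {0<..<1/100}" "s \<in> {1, -1}" for s \<epsilon>
  proof
    have eq: "det (aug_hessian s (z_split \<epsilon>) x) = det_value s \<epsilon> x" if "x \<in> ?B" for x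
      using that \<open>\<epsilon> \<in> _\<close> \<open>s \<in> _\<close> by (intro det_aug_hessian_ball) auto
    show "C2_norm ?B (\<lambda>x. det (aug_hessian s (z_split \<epsilon>) x)) = C2_norm ?B (det_value s \<epsilon>)"
      by (rule C2_norm_cong[OF open_ball eq])
    have "smooth_on UNIV (det_value s \<epsilon>)" using weighted_C2D(1)[OF weighted_C2_det_value] that by auto
    then have "Ck_on 2 ?B (det_value s \<epsilon>)" unfolding smooth_on_def using Ck_on_subset by blast
    then show "Ck_on 2 ?B (\<lambda>x. det (aug_hessian s (z_split \<epsilon>) x))"
      using Ck_on_cong[OF open_ball, of 0 "1/100" "det_value s \<epsilon>"] eq by auto
  qed
  have C2: "\<exists>C::real. \<forall>\<epsilon>\<in>{0<..<1/100}. Ck_on 2 ?B (\<lambda>x. det (aug_hessian s (z_split \<epsilon>) x)) \<and>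
      C2_norm ?B (\<lambda>x. det (aug_hessian s (z_split \<epsilon>) x)) \<le> ennreal C" if "s \<in> {1, -1}" for s
  proof -
    obtain C where "\<And>\<epsilon>. \<epsilon> \<in> {0<..<1} \<Longrightarrow> C2_norm ?B (det_value s \<epsilon>) \<le> ennreal C"
      using C2_norm_bounded[OF weighted_C2_det_value B] by blast
    then show ?thesis using det[OF _ that] by (intro exI[of _ C]) auto
  qed
  have C1': "\<exists>C::real. \<forall>\<epsilon>\<in>{0<..<1/100}. Ck_on 1 ?B (z_split \<epsilon>) \<and>
      C1_holder_norm (2 * a - 1) ?B (z_split \<epsilon>) \<le> ennreal C"
  proof -
    have "Ck_on 1 ?B (z_split \<epsilon>)" if "\<epsilon> > 0" for \<epsilon>
      using smooth_z_split[OF that] Ck_on_subset unfolding smooth_on_def by blast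
    then show ?thesis using C1 by (intro exI[of _ C1]) auto
  qed
  have pd: "\<forall>\<epsilon>\<in>{0<..<1/100}. \<forall>x\<in>?B. pos_definite (aug_hessian s (z_split \<epsilon>) x)" if "s \<in> {1, -1}" for s
    by (intro ballI pos_definite_aug_hessian) (use that in simp_all)
  show ?thesis
    unfolding z \<beta>
  \<comment> \<open>the radius and the bound on the parameter are both \<open>1/100\<close>\<close>
  proof (intro conjI[OF _ exI[of _ "1/100"], OF _ conjI[OF _ exI[of _ "1/100"]], OF _ _ conjI] ballI)
    show "\<forall>\<epsilon>>0. smooth_on UNIV (z_split \<epsilon>)" using smooth_z_split by blast
    fix s :: real assume s: "s \<in> {1, -1}"
    show "(\<forall>N. matrix_norm N \<longrightarrow> filterlim (\<lambda>\<epsilon>. N (hessian (z_split \<epsilon>) 0)) at_top (at_right 0)) \<and>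
      (\<exists>C::real. \<forall>\<epsilon>\<in>{0<..<1/100}. Ck_on 1 ?B (z_split \<epsilon>) \<and>
         C1_holder_norm (2 * a - 1) ?B (z_split \<epsilon>) \<le> ennreal C) \<and>
      (\<exists>C::real. \<forall>\<epsilon>\<in>{0<..<1/100}. Ck_on 2 ?B (\<lambda>x. det (aug_hessian s (z_split \<epsilon>) x)) \<and>
         C2_norm ?B (\<lambda>x. det (aug_hessian s (z_split \<epsilon>) x)) \<le> ennreal C) \<and>
      (\<forall>\<epsilon>\<in>{0<..<1/100}. \<forall>x\<in>?B. pos_definite (aug_hessian s (z_split \<epsilon>) x))"
      using hessian_blowup C1' C2[OF s] pd[OF s] by (intro conjI allI impI)
  qed simp_all
qed

end
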